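(* The collection of complete, separable metric spaces that are isometric to a subset of a Hilbert space is a strict subclass of the collection of metric spaces for which the Borel probability measures are determined by their values on balls.
   Context: The Borel probability measures on a metric space $(\mathcal X,d)$ are determined by their values on balls if any two Borel probability measures on $\mathcal X$ that agree on every open ball $\{y\in\mathcal X:d(x,y)<r\}$, $x\in\mathcal X$, $r>0$, are equal. "Strict subclass" means that the first collection is contained in the second, and that some metric space in the second collection does not belong to the first. *)

theory Defs
  imports "HOL-Probability.Probability_Measure" "HOL-Algebra.Module"
begin

section \<open>Real Hilbert spaces on carrier sets\<close>

text \<open>
  Being isometric to a subset of a Hilbert space quantifies existentially over Hilbert spaces,
  so Hilbert spaces are needed as objects (carrier-based records) and not just as types of class
  real inner product spaces. Complex Hilbert spaces need no separate treatment: with the real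
  part of the inner product they are real Hilbert spaces with the same metric.
\<close>

definition real_ring :: "real ring" where
  "real_ring = \<lparr>carrier = UNIV, monoid.mult = (*), one = 1, ring.zero = 0, add = (+)\<rparr>"

record 'v inner_module = "(real, 'v) module" +
  ip :: "'v \<Rightarrow> 'v \<Rightarrow> real"

locale real_inner_space = Module.module real_ring H for H :: "'v inner_module" +
  assumes ip_commute: "\<lbrakk>x \<in> carrier H; y \<in> carrier H\<rbrakk> \<Longrightarrow> ip H x y = ip H y x"
    and ip_add_left: "\<lbrakk>x \<in> carrier H; y \<in> carrier H; z \<in> carrier H\<rbrakk>
      \<Longrightarrow> ip H (x \<oplus>\<^bsub>H\<^esub> y) z = ip H x z + ip H y z"
    and ip_smult_left: "\<lbrakk>x \<in> carrier H; y \<in> carrier H\<rbrakk>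
      \<Longrightarrow> ip H (r \<odot>\<^bsub>H\<^esub> x) y = r * ip H x y"
    and ip_ge_zero: "x \<in> carrier H \<Longrightarrow> 0 \<le> ip H x x"
    and ip_eq_zero: "x \<in> carrier H \<Longrightarrow> ip H x x = 0 \<Longrightarrow> x = \<zero>\<^bsub>H\<^esub>"

text \<open>
  The library's metric-space predicate asks for nonnegativity and symmetry also outside the
  carrier, hence the value 0 there. That this really is a metric space is proved below.
\<close>

definition ip_dist :: "'v inner_module \<Rightarrow> 'v \<Rightarrow> 'v \<Rightarrow> real" where
  "ip_dist H x y = (if x \<in> carrier H \<and> y \<in> carrier H
     then sqrt (ip H (x \<ominus>\<^bsub>H\<^esub> y) (x \<ominus>\<^bsub>H\<^esub> y)) else 0)"

definition ip_metric :: "'v inner_module \<Rightarrow> 'v metric" where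
  "ip_metric H = metric (carrier H, ip_dist H)"

locale real_hilbert_space = real_inner_space H for H :: "'v inner_module" +
  assumes complete: "mcomplete_of (ip_metric H)"

section \<open>The two classes of metric spaces\<close>

definition isometric :: "'a metric \<Rightarrow> 'b metric \<Rightarrow> bool" where
  "isometric m m' \<longleftrightarrow> (\<exists>f. bij_betw f (mspace m) (mspace m') \<and>
     (\<forall>x\<in>mspace m. \<forall>y\<in>mspace m. mdist m' (f x) (f y) = mdist m x y))"

text \<open>
  A formula cannot quantify over types, so the Hilbert space is taken with carrier in a fixed
  type depending on the type of the points. This is no restriction: if \<open>m\<close> is isometric to a
  subset of a Hilbert space over an arbitrary type, then it is also isometric to a subset of one
  over this type (lemma \<open>isometric_to_hilbert_subsetI\<close> below), because each point of the
  closed linear span is determined by a sequence of formal linear combinations of points of \<open>m\<close>.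
\<close>

definition isometric_to_hilbert_subset :: "'a metric \<Rightarrow> bool" where
  "isometric_to_hilbert_subset m \<longleftrightarrow>
     (\<exists>(H :: (nat \<Rightarrow> ('a \<times> real) list) inner_module) S.
        real_hilbert_space H \<and> S \<subseteq> carrier H \<and> isometric m (submetric (ip_metric H) S))"

definition hilbertian_polish_spaces :: "'a metric set" where
  "hilbertian_polish_spaces = {m. mcomplete_of m \<and> separable_space (mtopology_of m) \<and>
     isometric_to_hilbert_subset m}"

definition borel_prob_measures :: "'a metric \<Rightarrow> 'a measure set" where
  "borel_prob_measures m = {P. prob_space P \<and>
     sets P = sets (sigma (mspace m) {U. openin (mtopology_of m) U})}"

definition ball_determined_spaces :: "'a metric set" where
  "ball_determined_spaces = {m. \<forall>P\<in>borel_prob_measures m. \<forall>Q\<in>borel_prob_measures m.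
     (\<forall>x\<in>mspace m. \<forall>r>0. emeasure P (mball_of m x r) = emeasure Q (mball_of m x r)) \<longrightarrow> P = Q}"

section \<open>Independence of the type carrying the Hilbert space\<close>

context real_inner_space
begin

lemma smult_in [simp, intro]: "x \<in> carrier H \<Longrightarrow> r \<odot>\<^bsub>H\<^esub> x \<in> carrier H"
  using smult_closed[of r x] by (simp add: real_ring_def)

lemma ip_add [simp]:
  assumes "x \<in> carrier H" "y \<in> carrier H" "z \<in> carrier H"
  shows "ip H (x \<oplus>\<^bsub>H\<^esub> y) z = ip H x z + ip H y z"
    "ip H z (x \<oplus>\<^bsub>H\<^esub> y) = ip H z x + ip H z y"
  using assms ip_commute[of z] by (auto simp: ip_add_left)

lemma ip_smult [simp]:
  assumes "x \<in> carrier H" "y \<in> carrier H"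
  shows "ip H (r \<odot>\<^bsub>H\<^esub> x) y = r * ip H x y" "ip H y (r \<odot>\<^bsub>H\<^esub> x) = r * ip H y x"
  using assms ip_commute[of y] by (auto simp: ip_smult_left)

lemma ip_minus [simp]:
  assumes "x \<in> carrier H" "y \<in> carrier H"
  shows "ip H (\<ominus>\<^bsub>H\<^esub> x) y = - ip H x y" "ip H y (\<ominus>\<^bsub>H\<^esub> x) = - ip H y x"
proof -
  have z: "ip H \<zero>\<^bsub>H\<^esub> y = 0"
    using ip_add_left[of "\<zero>\<^bsub>H\<^esub>" "\<zero>\<^bsub>H\<^esub>" y] assms by simp
  have "ip H (x \<oplus>\<^bsub>H\<^esub> \<ominus>\<^bsub>H\<^esub> x) y = ip H x y + ip H (\<ominus>\<^bsub>H\<^esub> x) y"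
    using assms by (intro ip_add_left) auto
  then show 1: "ip H (\<ominus>\<^bsub>H\<^esub> x) y = - ip H x y"
    using assms z by (simp add: M.r_neg)
  then show "ip H y (\<ominus>\<^bsub>H\<^esub> x) = - ip H y x"
    using assms ip_commute[of y "\<ominus>\<^bsub>H\<^esub> x"] ip_commute[of y x] by simp
qed

lemma Cauchy_Schwarz:
  assumes x: "x \<in> carrier H" and y: "y \<in> carrier H"
  shows "(ip H x y)\<^sup>2 \<le> ip H x x * ip H y y"
proof -
  define a b c where "a = ip H x x" "b = ip H x y" "c = ip H y y"
  have q: "0 \<le> a + 2 * t * b + t\<^sup>2 * c" for t
    using ip_ge_zero[of "x \<oplus>\<^bsub>H\<^esub> (t \<odot>\<^bsub>H\<^esub> y)"] x y ip_commute[of y x]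
    by (simp add: a_b_c_def algebra_simps power2_eq_square)
  have c: "c \<ge> 0" using ip_ge_zero[OF y] by (simp add: a_b_c_def)
  show ?thesis
  proof (cases "c = 0")
    case True
    have "b = 0"
    proof (rule ccontr)
      assume "b \<noteq> 0"
      then show False using q[of "- (a + 1) / (2 * b)"] True by (simp add: field_simps)
    qed
    then show ?thesis using True by (simp add: a_b_c_def)
  next
    case False
    then have "c > 0" using c by simp
    have "0 \<le> a + 2 * (- b / c) * b + (- b / c)\<^sup>2 * c" by (rule q)
    also have "\<dots> = a - b\<^sup>2 / c" using \<open>c > 0\<close> by (simp add: field_simps power2_eq_square)
    finally have "b\<^sup>2 \<le> a * c" using \<open>c > 0\<close> by (simp add: field_simps)
    then show ?thesis by (simp add: a_b_c_def)
  qed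
qed

definition nrm :: "'v \<Rightarrow> real" where "nrm x = sqrt (ip H x x)"

lemma nrm_triangle:
  assumes x: "x \<in> carrier H" and y: "y \<in> carrier H"
  shows "nrm (x \<oplus>\<^bsub>H\<^esub> y) \<le> nrm x + nrm y"
proof -
  have "ip H x y \<le> nrm x * nrm y"
    using real_le_rsqrt[OF Cauchy_Schwarz[OF x y]] by (simp add: nrm_def real_sqrt_mult)
  then have "ip H (x \<oplus>\<^bsub>H\<^esub> y) (x \<oplus>\<^bsub>H\<^esub> y) \<le> (nrm x + nrm y)\<^sup>2"
    using x y ip_commute[of y x] ip_ge_zero
    by (simp add: nrm_def power2_eq_square algebra_simps)
  then show ?thesis
    unfolding nrm_def[of "x \<oplus>\<^bsub>H\<^esub> y"] using x y ip_ge_zero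
    by (intro real_le_lsqrt) (auto simp: nrm_def)
qed

lemma ip_dist_eq: "\<lbrakk>x \<in> carrier H; y \<in> carrier H\<rbrakk> \<Longrightarrow> ip_dist H x y = nrm (x \<ominus>\<^bsub>H\<^esub> y)"
  by (simp add: ip_dist_def nrm_def)

lemma ip_dist_sq:
  "\<lbrakk>x \<in> carrier H; y \<in> carrier H\<rbrakk>
    \<Longrightarrow> ip_dist H x y = sqrt (ip H x x - 2 * ip H x y + ip H y y)"
  by (simp add: ip_dist_def a_minus_def ip_commute[of y x])

lemma Metric_space_ip_dist: "Metric_space (carrier H) (ip_dist H)"
proof
  fix x y z
  show "0 \<le> ip_dist H x y" by (simp add: ip_dist_def ip_ge_zero)
  show "ip_dist H x y = ip_dist H y x"
  proof (cases "x \<in> carrier H \<and> y \<in> carrier H")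
    case True
    then show ?thesis by (simp add: ip_dist_sq ip_commute[of y x] algebra_simps)
  qed (auto simp: ip_dist_def)
  assume x: "x \<in> carrier H" and y: "y \<in> carrier H"
  show "ip_dist H x y = 0 \<longleftrightarrow> x = y"
  proof
    assume "ip_dist H x y = 0"
    then have "x \<ominus>\<^bsub>H\<^esub> y = \<zero>\<^bsub>H\<^esub>" using x y by (simp add: ip_dist_def ip_eq_zero)
    moreover have "x = (x \<ominus>\<^bsub>H\<^esub> y) \<oplus>\<^bsub>H\<^esub> y"
      using x y by (simp add: a_minus_def M.a_assoc M.l_neg)
    ultimately show "x = y" using y by simp
  next
    assume "x = y"
    then show "ip_dist H x y = 0" using x y by (simp add: ip_dist_sq)
  qed
  assume z: "z \<in> carrier H"
  have "x \<ominus>\<^bsub>H\<^esub> z = (x \<ominus>\<^bsub>H\<^esub> y) \<oplus>\<^bsub>H\<^esub> (y \<ominus>\<^bsub>H\<^esub> z)"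
    using x y z by (simp add: a_minus_def M.a_assoc M.r_neg1 M.r_neg2)
  then show "ip_dist H x z \<le> ip_dist H x y + ip_dist H y z"
    using nrm_triangle[of "x \<ominus>\<^bsub>H\<^esub> y" "y \<ominus>\<^bsub>H\<^esub> z"] x y z by (simp add: ip_dist_eq)
qed

sublocale D: Metric_space "carrier H" "ip_dist H"
  by (rule Metric_space_ip_dist)

lemma mspace_ip_metric [simp]: "mspace (ip_metric H) = carrier H"
  by (simp add: ip_metric_def D.mspace_metric)

lemma mdist_ip_metric [simp]: "mdist (ip_metric H) = ip_dist H"
  by (simp add: ip_metric_def D.mdist_metric)

lemma ip_dist_add:
  assumes "x \<in> carrier H" "y \<in> carrier H" "x' \<in> carrier H" "y' \<in> carrier H"
  shows "ip_dist H (x \<oplus>\<^bsub>H\<^esub> y) (x' \<oplus>\<^bsub>H\<^esub> y') \<le> ip_dist H x x' + ip_dist H y y'"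
proof -
  have "(x \<oplus>\<^bsub>H\<^esub> y) \<ominus>\<^bsub>H\<^esub> (x' \<oplus>\<^bsub>H\<^esub> y') = (x \<ominus>\<^bsub>H\<^esub> x') \<oplus>\<^bsub>H\<^esub> (y \<ominus>\<^bsub>H\<^esub> y')"
    using assms by (simp add: a_minus_def M.minus_add M.a_ac)
  then show ?thesis
    using nrm_triangle[of "x \<ominus>\<^bsub>H\<^esub> x'" "y \<ominus>\<^bsub>H\<^esub> y'"] assms by (simp add: ip_dist_eq)
qed

lemma ip_dist_smult:
  assumes "x \<in> carrier H" "y \<in> carrier H"
  shows "ip_dist H (r \<odot>\<^bsub>H\<^esub> x) (r \<odot>\<^bsub>H\<^esub> y) = \<bar>r\<bar> * ip_dist H x y"
proof -
  have "r * (r * ip H x x) - 2 * (r * (r * ip H x y)) + r * (r * ip H y y)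
      = r\<^sup>2 * (ip H x x - 2 * ip H x y + ip H y y)"
    by (simp add: algebra_simps power2_eq_square)
  then show ?thesis
    using assms by (simp add: ip_dist_sq real_sqrt_mult del: right_diff_distrib)
qed

end

text \<open>A closed linear subspace of a Hilbert space can be copied into any type large enough.\<close>

lemma (in real_hilbert_space) transport:
  fixes e :: "'v \<Rightarrow> 'u"
  assumes W: "W \<subseteq> carrier H" and e: "inj_on e W"
    and zero: "\<zero>\<^bsub>H\<^esub> \<in> W"
    and add: "\<And>x y. \<lbrakk>x \<in> W; y \<in> W\<rbrakk> \<Longrightarrow> x \<oplus>\<^bsub>H\<^esub> y \<in> W"
    and smult: "\<And>r x. x \<in> W \<Longrightarrow> r \<odot>\<^bsub>H\<^esub> x \<in> W"
    and lim: "\<And>\<sigma> l. \<lbrakk>range \<sigma> \<subseteq> W; l \<in> carrier H; (\<lambda>n. ip_dist H (\<sigma> n) l) \<longlonglongrightarrow> 0\<rbrakk> \<Longrightarrow> l \<in> W"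
  shows "\<exists>H' :: 'u inner_module. real_hilbert_space H' \<and> carrier H' = e ` W \<and>
    (\<forall>x\<in>W. \<forall>y\<in>W. ip_dist H' (e x) (e y) = ip_dist H x y)"
proof -
  define g where "g = inv_into W e"
  have ge [simp]: "g (e x) = x" if "x \<in> W" for x
    using that e by (simp add: g_def)
  define H' :: "'u inner_module" where
    "H' = \<lparr>carrier = e ` W, monoid.mult = undefined, one = undefined, ring.zero = e \<zero>\<^bsub>H\<^esub>,
      add = (\<lambda>a b. e (g a \<oplus>\<^bsub>H\<^esub> g b)), smult = (\<lambda>r a. e (r \<odot>\<^bsub>H\<^esub> g a)),
      ip = (\<lambda>a b. ip H (g a) (g b))\<rparr>"
  have c [simp]: "x \<in> carrier H" if "x \<in> W" for x using that W by auto
  have inv: "((-1) \<odot>\<^bsub>H\<^esub> x) \<oplus>\<^bsub>H\<^esub> x = \<zero>\<^bsub>H\<^esub>" if "x \<in> W" for x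
    using that by (intro ip_eq_zero) auto
  have sm: "(r + s) \<odot>\<^bsub>H\<^esub> x = r \<odot>\<^bsub>H\<^esub> x \<oplus>\<^bsub>H\<^esub> s \<odot>\<^bsub>H\<^esub> x"
      "r \<odot>\<^bsub>H\<^esub> (x \<oplus>\<^bsub>H\<^esub> y) = r \<odot>\<^bsub>H\<^esub> x \<oplus>\<^bsub>H\<^esub> r \<odot>\<^bsub>H\<^esub> y"
      "(r * s) \<odot>\<^bsub>H\<^esub> x = r \<odot>\<^bsub>H\<^esub> (s \<odot>\<^bsub>H\<^esub> x)" "1 \<odot>\<^bsub>H\<^esub> x = x"
    if "x \<in> W" "y \<in> W" for r s x y
    using smult_l_distr[of r s x] smult_r_distr[of r x y] smult_assoc1[of r s x] smult_one[of x] that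
    by (auto simp: real_ring_def)
  interpret H': real_inner_space H'
  proof (intro real_inner_space.intro real_inner_space_axioms.intro moduleI)
    show "cring real_ring" by unfold_locales
    show "abelian_group H'"
    proof (rule abelian_groupI)
      fix x assume "x \<in> carrier H'"
      then obtain w where w: "w \<in> W" "x = e w" by (auto simp: H'_def)
      then show "\<exists>y\<in>carrier H'. y \<oplus>\<^bsub>H'\<^esub> x = \<zero>\<^bsub>H'\<^esub>"
        by (intro bexI[of _ "e ((-1) \<odot>\<^bsub>H\<^esub> w)"]) (auto simp: H'_def inv smult)
    qed (auto simp: H'_def add zero M.a_ac)
  next
    fix x assume "x \<in> carrier H'" "ip H' x x = 0"
    then show "x = \<zero>\<^bsub>H'\<^esub>" by (auto simp: H'_def dest!: ip_eq_zero[rotated])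
  qed (auto simp: H'_def real_ring_def add smult zero sm ip_ge_zero ip_commute)
  have car: "carrier H' = e ` W" by (simp add: H'_def)
  have dist: "ip_dist H' (e x) (e y) = ip_dist H x y" if "x \<in> W" "y \<in> W" for x y
    using that by (subst H'.ip_dist_sq) (auto simp: car ip_dist_sq, auto simp: H'_def)
  have "mcomplete_of (ip_metric H')"
  proof -
    have "\<exists>x. limitin H'.D.mtopology \<sigma> x sequentially" if \<sigma>: "H'.D.MCauchy \<sigma>" for \<sigma>
    proof -
      have "range \<sigma> \<subseteq> carrier H'" using \<sigma> unfolding H'.D.MCauchy_def by blast
      then have "\<forall>n. \<exists>w\<in>W. \<sigma> n = e w" unfolding car by blast
      then obtain \<tau> where \<tau>: "\<And>n. \<tau> n \<in> W" "\<And>n. \<sigma> n = e (\<tau> n)" by metis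
      then have "D.MCauchy \<tau>" using \<sigma> unfolding H'.D.MCauchy_def D.MCauchy_def
        by (auto simp: dist)
      then obtain l where l: "limitin D.mtopology \<tau> l sequentially"
        using complete by (auto simp: mcomplete_of_def D.mcomplete_def)
      then have lW: "l \<in> W"
        using \<tau> by (intro lim[of \<tau>]) (auto simp: D.limitin_metric_dist_null)
      then have "limitin H'.D.mtopology \<sigma> (e l) sequentially"
        using l \<tau> unfolding D.limitin_metric_dist_null H'.D.limitin_metric_dist_null
        by (simp only: car) (auto simp: dist)
      then show ?thesis ..
    qed
    then show ?thesis by (simp add: mcomplete_of_def H'.D.mcomplete_def)
  qed
  then have "real_hilbert_space H'"
    by (simp add: real_hilbert_space_def real_hilbert_space_axioms_def H'.real_inner_space_axioms)
  then show ?thesis using car dist by blast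
qed

lemma isometric_to_hilbert_subsetI:
  fixes m :: "'a metric" and H :: "'v inner_module"
  assumes H: "real_hilbert_space H" and S: "S \<subseteq> carrier H"
    and iso: "isometric m (submetric (ip_metric H) S)"
  shows "isometric_to_hilbert_subset m"
proof -
  interpret real_hilbert_space H by (rule H)
  have mS: "mspace (submetric (ip_metric H) S) = S"
    using S by auto
  obtain f where f: "bij_betw f (mspace m) S"
    and df: "\<And>x y. \<lbrakk>x \<in> mspace m; y \<in> mspace m\<rbrakk> \<Longrightarrow> ip_dist H (f x) (f y) = mdist m x y"
    using iso unfolding isometric_def mS by auto
  have fc: "f x \<in> carrier H" if "x \<in> mspace m" for x
    using that f S by (auto simp: bij_betw_def)
  have squeeze: "(\<lambda>n. ip_dist H (p n) q) \<longlonglongrightarrow> 0"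
    if "b \<longlonglongrightarrow> 0" "\<And>n. ip_dist H (p n) q \<le> b n" for p q and b :: "nat \<Rightarrow> real"
    by (rule real_tendsto_sandwich[OF _ _ tendsto_const that(1)]) (simp_all add: that(2))
  define lc where
    "lc = (\<lambda>ps :: ('a \<times> real) list. foldr (\<lambda>(x, r) v. r \<odot>\<^bsub>H\<^esub> f x \<oplus>\<^bsub>H\<^esub> v) ps \<zero>\<^bsub>H\<^esub>)"
  define ok where "ok = (\<lambda>ps :: ('a \<times> real) list. fst ` set ps \<subseteq> mspace m)"
  have lc_in [simp]: "lc ps \<in> carrier H" if "ok ps" for ps
    using that by (induction ps) (auto simp: lc_def ok_def fc)
  have lc_append: "lc (ps @ qs) = lc ps \<oplus>\<^bsub>H\<^esub> lc qs" if "ok ps" "ok qs" for ps qs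
    using that(1)
  proof (induction ps)
    case Nil
    then show ?case using lc_in[OF that(2)] by (simp add: lc_def)
  next
    case (Cons p ps)
    have "ok ps" "f (fst p) \<in> carrier H" using Cons.prems by (auto simp: ok_def fc)
    moreover have "lc ((p # ps) @ qs) = snd p \<odot>\<^bsub>H\<^esub> f (fst p) \<oplus>\<^bsub>H\<^esub> lc (ps @ qs)"
      "lc (p # ps) = snd p \<odot>\<^bsub>H\<^esub> f (fst p) \<oplus>\<^bsub>H\<^esub> lc ps"
      by (simp_all add: lc_def case_prod_unfold)
    ultimately show ?case using Cons.IH that(2) by (simp add: M.a_assoc)
  qed
  have lc_smult: "lc (map (\<lambda>(x, s). (x, r * s)) ps) = r \<odot>\<^bsub>H\<^esub> lc ps" if "ok ps" for ps r
    using that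
  proof (induction ps)
    case Nil
    have "r \<odot>\<^bsub>H\<^esub> \<zero>\<^bsub>H\<^esub> = \<zero>\<^bsub>H\<^esub>" by (intro smult_r_null) (simp add: real_ring_def)
    then show ?case by (simp add: lc_def)
  next
    case (Cons p ps)
    have ps: "ok ps" "f (fst p) \<in> carrier H" using Cons.prems by (auto simp: ok_def fc)
    have "lc (p # ps) = snd p \<odot>\<^bsub>H\<^esub> f (fst p) \<oplus>\<^bsub>H\<^esub> lc ps"
      "lc (map (\<lambda>(x, s). (x, r * s)) (p # ps))
        = (r * snd p) \<odot>\<^bsub>H\<^esub> f (fst p) \<oplus>\<^bsub>H\<^esub> lc (map (\<lambda>(x, s). (x, r * s)) ps)"
      by (simp_all add: lc_def case_prod_unfold)
    then show ?case
      using Cons.IH[OF ps(1)] ps smult_r_distr[of r "snd p \<odot>\<^bsub>H\<^esub> f (fst p)" "lc ps"]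
        smult_assoc1[of r "snd p" "f (fst p)"]
      by (simp add: real_ring_def)
  qed
  define approx where
    "approx = (\<lambda>s v. (\<forall>n. ok (s n)) \<and> (\<lambda>n. ip_dist H (lc (s n)) v) \<longlonglongrightarrow> 0)"
  define W where "W = {v \<in> carrier H. \<exists>s. approx s v}"
  define e where "e = (\<lambda>v. SOME s. approx s v)"
  have e: "approx (e v) v" if "v \<in> W" for v
    using that unfolding W_def e_def by (auto intro: someI_ex[of "\<lambda>s. approx s v"])
  have unique: "v = w"
    if vw: "v \<in> carrier H" "w \<in> carrier H" and s: "approx s v" "approx s w" for v w s
  proof -
    have "(\<lambda>n. ip_dist H (lc (s n)) v + ip_dist H (lc (s n)) w) \<longlonglongrightarrow> 0 + 0"
      using s by (intro tendsto_add) (auto simp: approx_def)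
    moreover have "ip_dist H v w \<le> ip_dist H (lc (s n)) v + ip_dist H (lc (s n)) w" for n
      using s vw by (intro D.triangle'') (auto simp: approx_def)
    ultimately have "ip_dist H v w \<le> 0"
      by (intro tendsto_lowerbound[where F = sequentially]) auto
    then show ?thesis using vw D.nonneg[of v w] D.zero[of v w] by auto
  qed
  have fW: "f x \<in> W" if "x \<in> mspace m" for x
  proof -
    have "lc [(x, 1)] = f x"
      using smult_one[of "f x"] fc[OF that] by (simp add: lc_def real_ring_def)
    then have "approx (\<lambda>n. [(x, 1)]) (f x)"
      using that fc[OF that] by (simp add: approx_def ok_def)
    then show ?thesis using fc[OF that] by (auto simp: W_def)
  qed
  have "\<exists>H' :: (nat \<Rightarrow> ('a \<times> real) list) inner_module. real_hilbert_space H' \<and> carrier H' = e ` W \<and>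
    (\<forall>x\<in>W. \<forall>y\<in>W. ip_dist H' (e x) (e y) = ip_dist H x y)"
  proof (rule transport)
    show "W \<subseteq> carrier H" by (auto simp: W_def)
    show "inj_on e W"
    proof (rule inj_onI)
      fix v w assume "v \<in> W" "w \<in> W" "e v = e w"
      then show "v = w" using e[of v] e[of w] unique[of v w "e v"] by (auto simp: W_def)
    qed
    have "approx (\<lambda>n. []) \<zero>\<^bsub>H\<^esub>" by (simp add: approx_def ok_def lc_def)
    then show "\<zero>\<^bsub>H\<^esub> \<in> W" by (auto simp: W_def)
  next
    fix v w assume vw: "v \<in> W" "w \<in> W"
    define s where "s n = e v n @ e w n" for n
    have c: "v \<in> carrier H" "w \<in> carrier H" using vw by (auto simp: W_def)
    have o: "ok (e v n)" "ok (e w n)" for n using e vw by (auto simp: approx_def)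
    have "(\<lambda>n. ip_dist H (lc (e v n)) v + ip_dist H (lc (e w n)) w) \<longlonglongrightarrow> 0 + 0"
      using e vw by (intro tendsto_add) (auto simp: approx_def)
    moreover have "ip_dist H (lc (s n)) (v \<oplus>\<^bsub>H\<^esub> w)
        \<le> ip_dist H (lc (e v n)) v + ip_dist H (lc (e w n)) w" for n
      unfolding s_def lc_append[OF o] by (rule ip_dist_add[OF lc_in[OF o(1)] lc_in[OF o(2)] c])
    ultimately have "(\<lambda>n. ip_dist H (lc (s n)) (v \<oplus>\<^bsub>H\<^esub> w)) \<longlonglongrightarrow> 0"
      by (intro squeeze) simp_all
    moreover have "ok (s n)" for n using o[of n] by (auto simp: s_def ok_def)
    ultimately show "v \<oplus>\<^bsub>H\<^esub> w \<in> W" using c by (auto simp: W_def approx_def)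
  next
    fix r v assume v: "v \<in> W"
    define s where "s n = map (\<lambda>(x, t). (x, r * t)) (e v n)" for n
    have c: "v \<in> carrier H" using v by (auto simp: W_def)
    have o: "ok (e v n)" for n using e v by (auto simp: approx_def)
    have "(\<lambda>n. \<bar>r\<bar> * ip_dist H (lc (e v n)) v) \<longlonglongrightarrow> \<bar>r\<bar> * 0"
      using e v by (intro tendsto_mult) (auto simp: approx_def)
    moreover have "ip_dist H (lc (s n)) (r \<odot>\<^bsub>H\<^esub> v) = \<bar>r\<bar> * ip_dist H (lc (e v n)) v" for n
      using o c by (simp add: s_def lc_smult ip_dist_smult)
    moreover have "ok (s n)" for n using o[of n] by (force simp: s_def ok_def)
    ultimately have "approx s (r \<odot>\<^bsub>H\<^esub> v)" by (simp add: approx_def)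
    then show "r \<odot>\<^bsub>H\<^esub> v \<in> W" using c by (auto simp: W_def)
  next
    fix \<sigma> l assume \<sigma>: "range \<sigma> \<subseteq> W" and l: "l \<in> carrier H"
      and lim: "(\<lambda>n. ip_dist H (\<sigma> n) l) \<longlonglongrightarrow> 0"
    have "\<exists>ps. ok ps \<and> ip_dist H (lc ps) (\<sigma> n) < inverse (real (Suc n))" for n
    proof -
      have "approx (e (\<sigma> n)) (\<sigma> n)" using e \<sigma> by blast
      then have "eventually (\<lambda>k. ip_dist H (lc (e (\<sigma> n) k)) (\<sigma> n) < inverse (real (Suc n))) sequentially"
        by (intro order_tendstoD[of _ 0]) (auto simp: approx_def)
      then show ?thesis
        using \<open>approx (e (\<sigma> n)) (\<sigma> n)\<close> by (auto simp: approx_def eventually_sequentially)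
    qed
    then obtain s where s: "\<And>n. ok (s n)"
        "\<And>n. ip_dist H (lc (s n)) (\<sigma> n) < inverse (real (Suc n))"
      by metis
    have "(\<lambda>n. inverse (real (Suc n)) + ip_dist H (\<sigma> n) l) \<longlonglongrightarrow> 0 + 0"
      by (intro tendsto_add LIMSEQ_inverse_real_of_nat lim)
    moreover have "ip_dist H (lc (s n)) l \<le> inverse (real (Suc n)) + ip_dist H (\<sigma> n) l" for n
    proof -
      have "\<sigma> n \<in> carrier H" using \<sigma> by (auto simp: W_def)
      then show ?thesis using D.triangle[of "lc (s n)" "\<sigma> n" l] s[of n] l by simp
    qed
    ultimately have "(\<lambda>n. ip_dist H (lc (s n)) l) \<longlonglongrightarrow> 0"
      by (intro squeeze) simp_all
    then show "l \<in> W" using s l by (auto simp: W_def approx_def)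
  qed
  then obtain H' :: "(nat \<Rightarrow> ('a \<times> real) list) inner_module"
    where H': "real_hilbert_space H'" "carrier H' = e ` W"
      and dH': "\<And>x y. \<lbrakk>x \<in> W; y \<in> W\<rbrakk> \<Longrightarrow> ip_dist H' (e x) (e y) = ip_dist H x y"
    by blast
  interpret H': real_hilbert_space H' by (rule H')
  define T where "T = (e \<circ> f) ` mspace m"
  have T: "T \<subseteq> carrier H'" using fW by (auto simp: T_def H')
  have dm: "ip_dist H' (e (f x)) (e (f y)) = mdist m x y"
    if "x \<in> mspace m" "y \<in> mspace m" for x y
    using that dH' df fW by simp
  have "inj_on (e \<circ> f) (mspace m)"
  proof (rule inj_onI)
    fix x y assume xy: "x \<in> mspace m" "y \<in> mspace m" "(e \<circ> f) x = (e \<circ> f) y"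
    then have "mdist m x y = ip_dist H' (e (f x)) (e (f x))" using dm[of x y] by simp
    also have "\<dots> = 0" using dm[of x x] xy by simp
    finally show "x = y" using xy by simp
  qed
  then have "isometric m (submetric (ip_metric H') T)"
    unfolding isometric_def using T dm
    by (intro exI[of _ "e \<circ> f"]) (auto simp: bij_betw_def T_def)
  then show ?thesis
    unfolding isometric_to_hilbert_subset_def using H'(1) T by blast
qed

lemma cring_real_ring: "cring real_ring"
proof (intro cringI abelian_groupI comm_monoidI)
  fix x assume "x \<in> carrier real_ring"
  then show "\<exists>y\<in>carrier real_ring. y \<oplus>\<^bsub>real_ring\<^esub> x = \<zero>\<^bsub>real_ring\<^esub>"
    by (intro bexI[of _ "- x"]) (simp_all add: real_ring_def)
qed (simp_all add: real_ring_def algebra_simps)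

text \<open>The Hilbert spaces given by the library's type classes are among those considered.\<close>

definition type_hilbert_space :: "'v::{real_inner, complete_space} inner_module" where
  "type_hilbert_space = \<lparr>carrier = UNIV, monoid.mult = undefined, one = undefined,
     ring.zero = 0, add = (+), smult = (*\<^sub>R), ip = (\<bullet>)\<rparr>"

lemma real_hilbert_space_type:
  "real_hilbert_space (type_hilbert_space :: 'v::{real_inner, complete_space} inner_module)"
  and mdist_type_hilbert_space: "mdist (ip_metric (type_hilbert_space :: 'v inner_module)) = dist"
proof -
  let ?H = "type_hilbert_space :: 'v inner_module"
  interpret real_inner_space ?H
  proof (intro real_inner_space.intro real_inner_space_axioms.intro moduleI)
    show "cring real_ring" by (rule cring_real_ring)
    show "abelian_group ?H"
    proof (rule abelian_groupI)
      fix x assume "x \<in> carrier ?H"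
      then show "\<exists>y\<in>carrier ?H. y \<oplus>\<^bsub>?H\<^esub> x = \<zero>\<^bsub>?H\<^esub>"
        by (intro bexI[of _ "- x"]) (simp_all add: type_hilbert_space_def)
    qed (simp_all add: type_hilbert_space_def algebra_simps)
  qed (simp_all add: type_hilbert_space_def real_ring_def algebra_simps inner_commute)
  have car: "carrier ?H = UNIV" by (simp add: type_hilbert_space_def)
  have d: "ip_dist ?H = dist"
  proof (intro ext)
    fix x y :: 'v
    show "ip_dist ?H x y = dist x y"
      by (subst ip_dist_sq)
        (simp_all add: type_hilbert_space_def dist_norm norm_eq_sqrt_inner inner_diff_left
          inner_diff_right inner_commute)
  qed
  show "mdist (ip_metric ?H) = dist" by (simp add: d)
  have "mcomplete_of (ip_metric ?H)"
    by (simp add: mcomplete_of_def car d complete_UNIV)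
  then show "real_hilbert_space ?H"
    by (simp add: real_hilbert_space_def real_hilbert_space_axioms_def real_inner_space_axioms)
qed

end

theory Submission
  imports Defs
begin

text \<open>
  Let \<open>f\<close> embed the separable metric space \<open>m\<close> isometrically into a Hilbert space, and let \<open>P\<close> and
  \<open>Q\<close> agree on the balls of \<open>m\<close>. Agreement on balls around \<open>x\<close> says that the distance to \<open>x\<close> has
  the same law under both measures, so every Gaussian \<open>exp (- t * d(x, y)\<^sup>2)\<close> centred at a point
  of \<open>m\<close> has equal integrals. The difficulty is to pass from one centre to several, because a
  single ball says nothing about intersections of balls.

  This is where the Hilbert space enters. The Gaussian kernel on it is positive semidefinite
  (\<open>psd_kernel_Gaussian\<close>, a consequence of the Schur product theorem \<open>psd_kernel_mult\<close>). The energy of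
  the signed measure \<open>P - Q\<close> with respect to this kernel is an integral of integrals of Gaussians
  centred in \<open>m\<close>, hence zero. By the Cauchy--Schwarz inequality for positive semidefinite forms,
  a measure of zero energy pairs to zero with the Gaussian at every point \<open>z\<close> of the Hilbert
  space, and not only at the points of \<open>m\<close> (\<open>integral_Gaussian_eq\<close>). A product of Gaussians of
  equal width is, up to a constant factor, the Gaussian at the barycentre of the centres, so products
  of Gaussians centred in \<open>m\<close> have equal integrals as well (\<open>integral_exp_sum_eq\<close>). Since the
  indicator of a ball is an iterated bounded limit of polynomials in the Gaussian at its centre
  (\<open>integral_indicator_greater_eq\<close>), \<open>P\<close> and \<open>Q\<close> agree on finite intersections of balls. These form
  an intersection-stable generator of the Borel sets of a separable space, and \<open>P = Q\<close> follows.

  The inclusion is strict because of the four-point star: a centre at distance 1 from three points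
  that are at mutual distance 2. In a Hilbert space the centre would be the midpoint of each pair of the
  outer points, which is absurd. On the other hand the open balls of radius 1 are the singletons, and
  these determine any measure on a finite set.
\<close>

section \<open>Positive semidefinite kernels\<close>

definition psd_kernel :: "'i set \<Rightarrow> ('i \<Rightarrow> 'i \<Rightarrow> real) \<Rightarrow> bool" where
  "psd_kernel I k \<longleftrightarrow> (\<forall>i\<in>I. \<forall>j\<in>I. k i j = k j i) \<and>
     (\<forall>F c. finite F \<longrightarrow> F \<subseteq> I \<longrightarrow> 0 \<le> (\<Sum>i\<in>F. \<Sum>j\<in>F. c i * c j * k i j))"

lemma psd_kernelI:
  assumes "\<And>i j. \<lbrakk>i \<in> I; j \<in> I\<rbrakk> \<Longrightarrow> k i j = k j i"
    and "\<And>F c. \<lbrakk>finite F; F \<subseteq> I\<rbrakk> \<Longrightarrow> 0 \<le> (\<Sum>i\<in>F. \<Sum>j\<in>F. c i * c j * k i j)"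
  shows "psd_kernel I k"
  using assms by (simp add: psd_kernel_def)

lemma psd_kernel_sym: "\<lbrakk>psd_kernel I k; i \<in> I; j \<in> I\<rbrakk> \<Longrightarrow> k i j = k j i"
  by (simp add: psd_kernel_def)

lemma psd_kernel_sum_nonneg:
  "\<lbrakk>psd_kernel I k; finite F; F \<subseteq> I\<rbrakk> \<Longrightarrow> 0 \<le> (\<Sum>i\<in>F. \<Sum>j\<in>F. c i * c j * k i j)"
  by (simp add: psd_kernel_def)

lemma psd_kernel_subset: "\<lbrakk>psd_kernel I k; J \<subseteq> I\<rbrakk> \<Longrightarrow> psd_kernel J k"
  unfolding psd_kernel_def by (meson subset_eq)

lemma psd_kernel_cong:
  assumes "psd_kernel I k" "\<And>i j. \<lbrakk>i \<in> I; j \<in> I\<rbrakk> \<Longrightarrow> k i j = k' i j"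
  shows "psd_kernel I k'"
proof (rule psd_kernelI)
  show "k' i j = k' j i" if "i \<in> I" "j \<in> I" for i j
    using assms psd_kernel_sym[OF assms(1) that] that by metis
  fix F c assume F: "finite F" "F \<subseteq> I"
  have "(\<Sum>i\<in>F. \<Sum>j\<in>F. c i * c j * k' i j) = (\<Sum>i\<in>F. \<Sum>j\<in>F. c i * c j * k i j)"
    using F assms(2) by (intro sum.cong refl arg_cong[where f = "\<lambda>x. _ * x"]) (metis subset_iff)
  then show "0 \<le> (\<Sum>i\<in>F. \<Sum>j\<in>F. c i * c j * k' i j)"
    using psd_kernel_sum_nonneg[OF assms(1) F] by simp
qed

lemma psd_kernel_diag_nonneg:
  assumes "psd_kernel I k" "i \<in> I"
  shows "0 \<le> k i i"
  using psd_kernel_sum_nonneg[OF assms(1), of "{i}" "\<lambda>_. 1"] assms(2) by simp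

lemma discriminant_le_if_nonneg:
  fixes a b c :: real
  assumes q: "\<And>t. 0 \<le> a + 2 * t * b + t\<^sup>2 * c" and c: "0 \<le> c"
  shows "b\<^sup>2 \<le> c * a"
proof (cases "c = 0")
  case True
  have "b = 0"
  proof (rule ccontr)
    assume "b \<noteq> 0"
    then show False using q[of "- (a + 1) / (2 * b)"] True by (simp add: field_simps)
  qed
  then show ?thesis using True by simp
next
  case False
  then have "c > 0" using c by simp
  have "0 \<le> a + 2 * (- b / c) * b + (- b / c)\<^sup>2 * c" by (rule q)
  also have "\<dots> = a - b\<^sup>2 / c" using \<open>c > 0\<close> by (simp add: field_simps power2_eq_square)
  finally show ?thesis using \<open>c > 0\<close> by (simp add: field_simps)
qed

text \<open>
  The nonnegative quadratic in \<open>t\<close> is the form evaluated at the weights \<open>c\<close> with mass \<open>t\<close> added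
  at \<open>z\<close>.
\<close>

lemma psd_kernel_Cauchy_Schwarz:
  assumes k: "psd_kernel I k" and F: "finite F" "F \<subseteq> I" and z: "z \<in> I"
  shows "(\<Sum>i\<in>F. c i * k z i)\<^sup>2 \<le> k z z * (\<Sum>i\<in>F. \<Sum>j\<in>F. c i * c j * k i j)"
proof (rule discriminant_le_if_nonneg)
  show "0 \<le> k z z" using psd_kernel_diag_nonneg[OF k z] .
  fix t :: real
  define G where "G = insert z F"
  define e where "e i = (if i \<in> F then c i else 0)" for i
  define \<delta> where "\<delta> i = (if i = z then t else 0)" for i
  have G: "finite G" "G \<subseteq> I" "z \<in> G" using F z by (auto simp: G_def)
  have eF: "(\<Sum>i\<in>G. e i * x i) = (\<Sum>i\<in>F. c i * x i)" for x
    using F by (intro sum.mono_neutral_cong_right) (auto simp: G_def e_def)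
  have dz: "(\<Sum>i\<in>G. \<delta> i * x i) = t * x z" for x
  proof -
    have "(\<Sum>i\<in>G. \<delta> i * x i) = (\<Sum>i\<in>G. if i = z then t * x i else 0)"
      by (intro sum.cong) (auto simp: \<delta>_def)
    also have "\<dots> = t * x z" using G by (simp add: sum.delta')
    finally show ?thesis .
  qed
  have inner: "(\<Sum>j\<in>G. (e i + \<delta> i) * (e j + \<delta> j) * k i j)
      = (e i + \<delta> i) * ((\<Sum>j\<in>F. c j * k i j) + t * k i z)" for i
  proof -
    have "(\<Sum>j\<in>G. (e i + \<delta> i) * (e j + \<delta> j) * k i j)
      = (e i + \<delta> i) * ((\<Sum>j\<in>G. e j * k i j) + (\<Sum>j\<in>G. \<delta> j * k i j))"
      by (simp add: sum_distrib_left sum.distrib[symmetric] algebra_simps)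
    then show ?thesis by (simp add: eF dz)
  qed
  have "0 \<le> (\<Sum>i\<in>G. \<Sum>j\<in>G. (e i + \<delta> i) * (e j + \<delta> j) * k i j)"
    by (rule psd_kernel_sum_nonneg[OF k G(1,2)])
  also have "\<dots> = (\<Sum>i\<in>G. (e i + \<delta> i) * ((\<Sum>j\<in>F. c j * k i j) + t * k i z))"
    by (simp add: inner)
  also have "\<dots> = (\<Sum>i\<in>G. e i * ((\<Sum>j\<in>F. c j * k i j) + t * k i z))
       + (\<Sum>i\<in>G. \<delta> i * ((\<Sum>j\<in>F. c j * k i j) + t * k i z))"
    by (simp add: ring_distribs sum.distrib)
  also have "\<dots> = (\<Sum>i\<in>F. c i * ((\<Sum>j\<in>F. c j * k i j) + t * k i z))
       + t * ((\<Sum>j\<in>F. c j * k z j) + t * k z z)"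
    by (simp only: eF dz)
  also have "(\<Sum>i\<in>F. c i * ((\<Sum>j\<in>F. c j * k i j) + t * k i z))
     = (\<Sum>i\<in>F. \<Sum>j\<in>F. c i * c j * k i j) + t * (\<Sum>i\<in>F. c i * k z i)"
  proof -
    have "k i z = k z i" if "i \<in> F" for i
      using psd_kernel_sym[OF k, of i z] that F z by auto
    then show ?thesis
      by (simp add: distrib_left sum.distrib sum_distrib_left mult.assoc mult.left_commute)
  qed
  finally show "0 \<le> (\<Sum>i\<in>F. \<Sum>j\<in>F. c i * c j * k i j) + 2 * t * (\<Sum>i\<in>F. c i * k z i) + t\<^sup>2 * k z z"
    by (simp add: power2_eq_square algebra_simps)
qed

text \<open>One step of Gaussian elimination; division by \<open>A z z = 0\<close> is harmless because the row of
  \<open>z\<close> vanishes in that case by Cauchy--Schwarz.\<close>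

lemma psd_kernel_Schur_complement:
  assumes A: "psd_kernel I A" and z: "z \<in> I"
  shows "psd_kernel I (\<lambda>i j. A i j - A z i * A z j / A z z)"
    and "i \<in> I \<Longrightarrow> A z i - A z z * A z i / A z z = 0"
proof (rule psd_kernelI)
  show "A i j - A z i * A z j / A z z = A j i - A z j * A z i / A z z" if "i \<in> I" "j \<in> I" for i j
    using psd_kernel_sym[OF A that] by (simp add: mult.commute)
  fix F c assume F: "finite F" "F \<subseteq> I"
  define S where "S = (\<Sum>i\<in>F. c i * A z i)"
  have "(\<Sum>i\<in>F. \<Sum>j\<in>F. c i * c j * (A i j - A z i * A z j / A z z))
     = (\<Sum>i\<in>F. \<Sum>j\<in>F. c i * c j * A i j) - (\<Sum>i\<in>F. \<Sum>j\<in>F. (c i * A z i) * (c j * A z j)) / A z z"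
    by (simp add: sum_subtractf[symmetric] sum_divide_distrib algebra_simps)
  also have "(\<Sum>i\<in>F. \<Sum>j\<in>F. (c i * A z i) * (c j * A z j)) = S\<^sup>2"
    by (simp add: S_def power2_eq_square sum_product)
  finally have eq: "(\<Sum>i\<in>F. \<Sum>j\<in>F. c i * c j * (A i j - A z i * A z j / A z z))
     = (\<Sum>i\<in>F. \<Sum>j\<in>F. c i * c j * A i j) - S\<^sup>2 / A z z" .
  have "S\<^sup>2 / A z z \<le> (\<Sum>i\<in>F. \<Sum>j\<in>F. c i * c j * A i j)"
    using psd_kernel_Cauchy_Schwarz[OF A F z, of c] psd_kernel_diag_nonneg[OF A z]
      psd_kernel_sum_nonneg[OF A F, of c]
    by (cases "A z z = 0") (simp_all add: S_def divide_le_eq mult.commute)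
  then show "0 \<le> (\<Sum>i\<in>F. \<Sum>j\<in>F. c i * c j * (A i j - A z i * A z j / A z z))"
    by (simp add: eq)
next
  assume i: "i \<in> I"
  have "A z i = 0" if "A z z = 0"
    using psd_kernel_Cauchy_Schwarz[OF A, of "{i}" z "\<lambda>_. 1"] i z that by simp
  then show "A z i - A z z * A z i / A z z = 0" by auto
qed

text \<open>
  The Schur product theorem. Elimination writes \<open>A\<close> as a rank one kernel \<open>a i * a j\<close> plus a kernel
  in which one index no longer occurs. The form of the product with the rank one kernel is the
  form of \<open>B\<close> at the weights \<open>c i * a i\<close>, and induction on the number of indices takes care
  of the remainder.
\<close>

lemma psd_kernel_mult:
  assumes A: "psd_kernel I A" and B: "psd_kernel I B"
  shows "psd_kernel I (\<lambda>i j. A i j * B i j)"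
proof (rule psd_kernelI)
  show "A i j * B i j = A j i * B j i" if "i \<in> I" "j \<in> I" for i j
    using psd_kernel_sym[OF A that] psd_kernel_sym[OF B that] by simp
  fix F c assume F: "finite F" "F \<subseteq> I"
  have "\<lbrakk>finite F; psd_kernel F A; psd_kernel F B\<rbrakk>
      \<Longrightarrow> 0 \<le> (\<Sum>i\<in>F. \<Sum>j\<in>F. c i * c j * (A i j * B i j))" for A B
  proof (induction F arbitrary: A rule: finite_induct)
    case empty
    then show ?case by simp
  next
    case (insert z F)
    let ?G = "insert z F"
    define A' where "A' i j = A i j - A z i * A z j / A z z" for i j
    have A': "psd_kernel ?G A'" and row: "\<And>i. i \<in> ?G \<Longrightarrow> A' z i = 0"
      using psd_kernel_Schur_complement[OF insert.prems(1), of z] by (simp_all add: A'_def[abs_def])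
    have col: "A' i z = 0" if "i \<in> ?G" for i
      using psd_kernel_sym[OF A', of i z] row that by simp
    have "c i * c j * (A i j * B i j) = c i * c j * (A' i j * B i j)
        + (c i * A z i) * (c j * A z j) * B i j / A z z" for i j
      by (simp add: A'_def algebra_simps)
    then have "(\<Sum>i\<in>?G. \<Sum>j\<in>?G. c i * c j * (A i j * B i j))
      = (\<Sum>i\<in>?G. \<Sum>j\<in>?G. c i * c j * (A' i j * B i j)
           + (c i * A z i) * (c j * A z j) * B i j / A z z)"
      by (simp only:)
    also have "\<dots> = (\<Sum>i\<in>?G. \<Sum>j\<in>?G. c i * c j * (A' i j * B i j))
      + (\<Sum>i\<in>?G. \<Sum>j\<in>?G. (c i * A z i) * (c j * A z j) * B i j) / A z z"
      by (simp only: sum.distrib sum_divide_distrib)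
    also have "(\<Sum>i\<in>?G. \<Sum>j\<in>?G. c i * c j * (A' i j * B i j))
       = (\<Sum>i\<in>F. \<Sum>j\<in>F. c i * c j * (A' i j * B i j))"
      using insert.hyps row col by simp
    finally have eq: "(\<Sum>i\<in>?G. \<Sum>j\<in>?G. c i * c j * (A i j * B i j))
      = (\<Sum>i\<in>F. \<Sum>j\<in>F. c i * c j * (A' i j * B i j))
        + (\<Sum>i\<in>?G. \<Sum>j\<in>?G. (c i * A z i) * (c j * A z j) * B i j) / A z z" .
    have "0 \<le> (\<Sum>i\<in>F. \<Sum>j\<in>F. c i * c j * (A' i j * B i j))"
      using insert.IH[of A'] A' insert.prems(2) by (meson psd_kernel_subset subset_insertI)
    moreover have "0 \<le> (\<Sum>i\<in>?G. \<Sum>j\<in>?G. (c i * A z i) * (c j * A z j) * B i j) / A z z"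
      using insert.hyps psd_kernel_sum_nonneg[OF insert.prems(2), of ?G "\<lambda>i. c i * A z i"]
        psd_kernel_diag_nonneg[OF insert.prems(1), of z]
      by (intro divide_nonneg_nonneg) simp_all
    ultimately show ?case unfolding eq by (rule add_nonneg_nonneg)
  qed
  then show "0 \<le> (\<Sum>i\<in>F. \<Sum>j\<in>F. c i * c j * (A i j * B i j))"
    using F psd_kernel_subset[OF A] psd_kernel_subset[OF B] by blast
qed

lemma psd_kernel_rank_one: "psd_kernel I (\<lambda>i j. a i * a j)"
proof (rule psd_kernelI)
  fix F c
  have "(\<Sum>i\<in>F. \<Sum>j\<in>F. c i * c j * (a i * a j)) = (\<Sum>i\<in>F. c i * a i)\<^sup>2"
    by (simp add: power2_eq_square sum_product algebra_simps)
  then show "0 \<le> (\<Sum>i\<in>F. \<Sum>j\<in>F. c i * c j * (a i * a j))" by simp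
qed simp

lemma psd_kernel_power: "psd_kernel I k \<Longrightarrow> psd_kernel I (\<lambda>i j. k i j ^ n)"
proof (induction n)
  case 0
  then show ?case using psd_kernel_rank_one[of I "\<lambda>_. 1"] by simp
next
  case (Suc n)
  then show ?case using psd_kernel_mult by simp
qed

lemma psd_kernel_scale:
  assumes "psd_kernel I k" "0 \<le> r"
  shows "psd_kernel I (\<lambda>i j. r * k i j)"
  using psd_kernel_mult[OF psd_kernel_rank_one[of I "\<lambda>_. sqrt r"] assms(1)] assms(2) by simp

lemma psd_kernel_sum:
  assumes "\<And>n. n \<in> N \<Longrightarrow> psd_kernel I (k n)"
  shows "psd_kernel I (\<lambda>i j. \<Sum>n\<in>N. k n i j)"
proof (rule psd_kernelI)
  show "(\<Sum>n\<in>N. k n i j) = (\<Sum>n\<in>N. k n j i)" if "i \<in> I" "j \<in> I" for i j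
    using psd_kernel_sym[OF assms] that by (intro sum.cong) auto
  fix F c assume F: "finite F" "F \<subseteq> I"
  have "(\<Sum>i\<in>F. \<Sum>j\<in>F. c i * c j * (\<Sum>n\<in>N. k n i j))
      = (\<Sum>n\<in>N. \<Sum>i\<in>F. \<Sum>j\<in>F. c i * c j * k n i j)"
    unfolding sum_distrib_left by (simp only: sum.swap[of _ N F])
  also have "0 \<le> \<dots>" using assms F by (intro sum_nonneg psd_kernel_sum_nonneg) auto
  finally show "0 \<le> (\<Sum>i\<in>F. \<Sum>j\<in>F. c i * c j * (\<Sum>n\<in>N. k n i j))" .
qed

lemma psd_kernel_limit:
  assumes k: "\<And>n :: nat. psd_kernel I (k n)"
    and lim: "\<And>i j. \<lbrakk>i \<in> I; j \<in> I\<rbrakk> \<Longrightarrow> (\<lambda>n. k n i j) \<longlonglongrightarrow> l i j"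
  shows "psd_kernel I l"
proof (rule psd_kernelI)
  show "l i j = l j i" if "i \<in> I" "j \<in> I" for i j
    using lim[OF that] lim[OF that(2,1)] psd_kernel_sym[OF k that] LIMSEQ_unique by simp
  fix F c assume F: "finite F" "F \<subseteq> I"
  have "(\<lambda>n. \<Sum>i\<in>F. \<Sum>j\<in>F. c i * c j * k n i j) \<longlonglongrightarrow> (\<Sum>i\<in>F. \<Sum>j\<in>F. c i * c j * l i j)"
    using F by (intro tendsto_sum tendsto_mult_left lim) auto
  then show "0 \<le> (\<Sum>i\<in>F. \<Sum>j\<in>F. c i * c j * l i j)"
    by (rule LIMSEQ_le_const) (use psd_kernel_sum_nonneg[OF k F] in blast)
qed

text \<open>The power series of \<open>exp\<close> has nonnegative coefficients.\<close>

lemma psd_kernel_exp: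
  assumes "psd_kernel I k"
  shows "psd_kernel I (\<lambda>i j. exp (k i j))"
proof (rule psd_kernel_limit)
  show "psd_kernel I (\<lambda>i j. \<Sum>m<n. inverse (fact m) * k i j ^ m)" for n
    using assms by (intro psd_kernel_sum psd_kernel_scale psd_kernel_power) auto
  show "(\<lambda>n. \<Sum>m<n. inverse (fact m) * k i j ^ m) \<longlonglongrightarrow> exp (k i j)" for i j
    using exp_converges[of "k i j"] by (simp add: sums_def)
qed

section \<open>The Gaussian kernel of a Hilbert space\<close>

context real_inner_space
begin

lemma ip_zero_left [simp]: "x \<in> carrier H \<Longrightarrow> ip H \<zero>\<^bsub>H\<^esub> x = 0"
  using ip_add_left[of "\<zero>\<^bsub>H\<^esub>" "\<zero>\<^bsub>H\<^esub>" x] by simp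

lemma ex_linear_combination:
  assumes "set ps \<subseteq> carrier H"
  shows "\<exists>v\<in>carrier H. \<forall>w\<in>carrier H. ip H v w = (\<Sum>x\<leftarrow>ps. r * ip H x w)"
  using assms
proof (induction ps)
  case Nil
  show ?case by (intro bexI[of _ "\<zero>\<^bsub>H\<^esub>"]) auto
next
  case (Cons p ps)
  then obtain v where v: "v \<in> carrier H" "\<forall>w\<in>carrier H. ip H v w = (\<Sum>x\<leftarrow>ps. r * ip H x w)"
    by auto
  then show ?case using Cons.prems
    by (intro bexI[of _ "(r \<odot>\<^bsub>H\<^esub> p) \<oplus>\<^bsub>H\<^esub> v"]) auto
qed

text \<open>The quadratic form at the weights \<open>c\<close> is the squared norm of \<open>\<Sum>i\<in>F. c i * h i\<close>. Points are
  indexed by a map \<open>h\<close> that need not be injective, so that point sequences with repetitions are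
  covered.\<close>

lemma psd_kernel_ip:
  assumes h: "\<And>i. i \<in> I \<Longrightarrow> h i \<in> carrier H"
  shows "psd_kernel I (\<lambda>i j. ip H (h i) (h j))"
proof (rule psd_kernelI)
  show "ip H (h i) (h j) = ip H (h j) (h i)" if "i \<in> I" "j \<in> I" for i j
    using that h by (intro ip_commute) auto
  fix F c assume F: "finite F" "F \<subseteq> I"
  then have "\<exists>v\<in>carrier H. \<forall>w\<in>carrier H. ip H v w = (\<Sum>i\<in>F. c i * ip H (h i) w)"
  proof (induction F rule: finite_induct)
    case empty
    show ?case by (intro bexI[of _ "\<zero>\<^bsub>H\<^esub>"]) auto
  next
    case (insert i F)
    then obtain v where v: "v \<in> carrier H" "\<forall>w\<in>carrier H. ip H v w = (\<Sum>i\<in>F. c i * ip H (h i) w)"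
      by auto
    then show ?case using insert h
      by (intro bexI[of _ "(c i \<odot>\<^bsub>H\<^esub> h i) \<oplus>\<^bsub>H\<^esub> v"]) auto
  qed
  then obtain v where v: "v \<in> carrier H"
    "\<And>w. w \<in> carrier H \<Longrightarrow> ip H v w = (\<Sum>i\<in>F. c i * ip H (h i) w)" by blast
  have "0 \<le> ip H v v" using v(1) by (rule ip_ge_zero)
  also have "\<dots> = (\<Sum>i\<in>F. c i * ip H v (h i))"
    unfolding v(2)[OF v(1)] using F h v(1) by (intro sum.cong) (auto simp: ip_commute)
  also have "\<dots> = (\<Sum>i\<in>F. c i * (\<Sum>j\<in>F. c j * ip H (h j) (h i)))"
    using F h v(2) by (intro sum.cong) auto
  also have "\<dots> = (\<Sum>i\<in>F. \<Sum>j\<in>F. c i * c j * ip H (h i) (h j))"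
    using F h ip_commute
    by (simp add: sum_distrib_left mult.assoc) (intro sum.cong refl, simp add: subset_iff)
  finally show "0 \<le> (\<Sum>i\<in>F. \<Sum>j\<in>F. c i * c j * ip H (h i) (h j))" .
qed

lemma ip_dist_square:
  assumes "x \<in> carrier H" "y \<in> carrier H"
  shows "(ip_dist H x y)\<^sup>2 = ip H x x - 2 * ip H x y + ip H y y"
  using D.nonneg[of x y] ip_dist_sq[OF assms] by auto

text \<open>Expanding the square gives \<open>exp (- t|x - y|\<^sup>2) = a x * a y * exp (2 * t * \<langle>x, y\<rangle>)\<close>
  with \<open>a x = exp (- t|x|\<^sup>2)\<close>: a rank one kernel times the exponential of a multiple of the inner
  product.\<close>

lemma psd_kernel_Gaussian:
  assumes h: "\<And>i. i \<in> I \<Longrightarrow> h i \<in> carrier H" and t: "0 \<le> t"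
  shows "psd_kernel I (\<lambda>i j. exp (- (t * (ip_dist H (h i) (h j))\<^sup>2)))"
proof (rule psd_kernel_cong)
  show "psd_kernel I (\<lambda>i j. (exp (- (t * ip H (h i) (h i))) * exp (- (t * ip H (h j) (h j))))
      * exp ((2 * t) * ip H (h i) (h j)))"
    using t h by (intro psd_kernel_mult psd_kernel_rank_one psd_kernel_exp psd_kernel_scale
      psd_kernel_ip) auto
  fix i j assume "i \<in> I" "j \<in> I"
  then have c: "h i \<in> carrier H" "h j \<in> carrier H" using h by auto
  show "exp (- (t * ip H (h i) (h i))) * exp (- (t * ip H (h j) (h j)))
      * exp ((2 * t) * ip H (h i) (h j)) = exp (- (t * (ip_dist H (h i) (h j))\<^sup>2))"
    by (simp only: exp_add[symmetric] ip_dist_square[OF c])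
      (simp add: right_diff_distrib distrib_left)
qed

end

section \<open>Borel probability measures on separable metric spaces\<close>

lemma space_borel_prob_measures:
  assumes "P \<in> borel_prob_measures m"
  shows "space P = mspace m"
proof -
  have "sets P = sets (sigma (mspace m) {U. openin (mtopology_of m) U})"
    using assms by (simp add: borel_prob_measures_def)
  from sets_eq_imp_space_eq[OF this] show ?thesis by (simp only: space_measure_of_conv)
qed

lemma sets_borel_prob_measures:
  assumes "P \<in> borel_prob_measures m"
  shows "sets P = sigma_sets (mspace m) {U. openin (mtopology_of m) U}"
proof -
  have "{U. openin (mtopology_of m) U} \<subseteq> Pow (mspace m)"
    using openin_subset by fastforce
  then show ?thesis using assms by (auto simp: borel_prob_measures_def sets_measure_of)
qed

lemma prob_space_borel_prob_measures: "P \<in> borel_prob_measures m \<Longrightarrow> prob_space P"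
  by (simp add: borel_prob_measures_def)

lemma openin_mball_of: "openin (mtopology_of m) (mball_of m x r)"
proof -
  interpret Metric_space "mspace m" "mdist m" by (rule Metric_space_mspace_mdist)
  show ?thesis unfolding mtopology_of_def mball_of_def by (rule openin_mball)
qed

lemma mball_of_in_sets:
  assumes "P \<in> borel_prob_measures m"
  shows "mball_of m x r \<in> sets P"
  unfolding sets_borel_prob_measures[OF assms]
  by (rule sigma_sets.Basic) (simp add: openin_mball_of)

lemma mdist_measurable:
  assumes P: "P \<in> borel_prob_measures m" and x: "x \<in> mspace m"
  shows "mdist m x \<in> borel_measurable P"
  unfolding borel_measurable_iff_less
proof
  fix r
  have "{y \<in> space P. mdist m x y < r} = mball_of m x r"
    using x by (auto simp: space_borel_prob_measures[OF P])
  then show "{y \<in> space P. mdist m x y < r} \<in> sets P"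
    using mball_of_in_sets[OF P] by simp
qed

lemma separable_space_dense_sequence:
  assumes sep: "separable_space (mtopology_of m)" and ne: "mspace m \<noteq> {}"
  obtains s :: "nat \<Rightarrow> 'a" where "\<And>i. s i \<in> mspace m"
    "\<And>x e. \<lbrakk>x \<in> mspace m; e > 0\<rbrakk> \<Longrightarrow> \<exists>i. mdist m (s i) x < e"
proof -
  obtain D where D: "countable D" "D \<subseteq> mspace m" "mtopology_of m closure_of D = mspace m"
    using sep by (auto simp: separable_space_def)
  have dense: "\<exists>y\<in>D. mdist m y x < e" if "x \<in> mspace m" "e > 0" for x e
  proof -
    have "x \<in> mtopology_of m closure_of D" using D that by simp
    moreover have "mdist m x x = 0" using that(1) by simp
    then have "mdist m x x < e" using that(2) by linarith
    then have xb: "x \<in> mball_of m x e" using that(1) by simp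
    ultimately obtain y where "y \<in> D" "y \<in> mball_of m x e"
      using openin_mball_of[of m x e] xb unfolding in_closure_of by blast
    then show ?thesis by (auto simp: mdist_commute)
  qed
  then have "D \<noteq> {}" using ne zero_less_one by blast
  show ?thesis
  proof (rule that[of "from_nat_into D"])
    show "from_nat_into D i \<in> mspace m" for i
      using from_nat_into[OF \<open>D \<noteq> {}\<close>] D(2) by blast
    show "\<exists>i. mdist m (from_nat_into D i) x < e" if "x \<in> mspace m" "e > 0" for x e
      using dense[OF that] from_nat_into_surj[OF D(1)] by metis
  qed
qed

text \<open>Composed with the dense sequence \<open>s\<close>, this is a sequence of measurable maps with finite range
  that converges pointwise to the identity. It replaces a measure by finitely many point masses. The
  \<open>LEAST\<close> breaks ties measurably.\<close>

definition nearest :: "'a metric \<Rightarrow> (nat \<Rightarrow> 'a) \<Rightarrow> nat \<Rightarrow> 'a \<Rightarrow> nat" where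
  "nearest m s n x = (LEAST i. i \<le> n \<and> (\<forall>j\<in>{..n}. mdist m (s i) x \<le> mdist m (s j) x))"

lemma nearest:
  shows nearest_le: "nearest m s n x \<le> n"
    and nearest_min: "j \<le> n \<Longrightarrow> mdist m (s (nearest m s n x)) x \<le> mdist m (s j) x"
proof -
  have "\<exists>i\<in>{..n}. \<forall>j\<in>{..n}. mdist m (s i) x \<le> mdist m (s j) x"
    using ex_min_if_finite[of "(\<lambda>i. mdist m (s i) x) ` {..n}"] by (fastforce simp: not_less)
  then have "\<exists>i. i \<le> n \<and> (\<forall>j\<in>{..n}. mdist m (s i) x \<le> mdist m (s j) x)" by auto
  from LeastI_ex[OF this]
  show "nearest m s n x \<le> n"
    "j \<le> n \<Longrightarrow> mdist m (s (nearest m s n x)) x \<le> mdist m (s j) x"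
    unfolding nearest_def by auto
qed

lemma nearest_tendsto:
  assumes "\<And>e. e > 0 \<Longrightarrow> \<exists>i. mdist m (s i) x < e"
  shows "(\<lambda>n. mdist m (s (nearest m s n x)) x) \<longlonglongrightarrow> 0"
proof (rule LIMSEQ_I)
  fix e :: real assume "e > 0"
  then obtain i where "mdist m (s i) x < e" using assms by blast
  then have "norm (mdist m (s (nearest m s n x)) x - 0) < e" if "n \<ge> i" for n
    using nearest_min[OF that, of m s x] by simp
  then show "\<exists>N. \<forall>n\<ge>N. norm (mdist m (s (nearest m s n x)) x - 0) < e" by blast
qed

lemma nearest_measurable:
  assumes P: "P \<in> borel_prob_measures m" and s: "\<And>i. s i \<in> mspace m"
  shows "nearest m s n \<in> measurable P (count_space UNIV)"
proof -
  have [measurable]: "mdist m (s i) \<in> borel_measurable P" for i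
    by (rule mdist_measurable[OF P s])
  show ?thesis unfolding nearest_def by measurable
qed

lemma (in prob_space) integral_finite_range:
  fixes h :: "nat \<Rightarrow> real"
  assumes \<iota>[measurable]: "\<iota> \<in> measurable M (count_space UNIV)" and le: "\<And>x. \<iota> x \<le> n"
  shows "integrable M (\<lambda>x. h (\<iota> x))"
    and "(\<integral>x. h (\<iota> x) \<partial>M) = (\<Sum>i\<le>n. prob {x \<in> space M. \<iota> x = i} * h i)"
proof -
  let ?A = "\<lambda>i. {x \<in> space M. \<iota> x = i}"
  have eq: "h (\<iota> x) = (\<Sum>i\<le>n. indicator (?A i) x * h i)" if "x \<in> space M" for x
  proof -
    have "(\<Sum>i\<le>n. indicator (?A i) x * h i) = (\<Sum>i\<le>n. if i = \<iota> x then h i else 0)"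
      using that by (intro sum.cong refl) (simp add: indicator_def eq_commute)
    also have "\<dots> = h (\<iota> x)" using le[of x] by (subst sum.delta) auto
    finally show ?thesis by (rule sym)
  qed
  have int: "integrable M (\<lambda>x. indicator (?A i) x * h i)" for i
    by (intro integrable_mult_left) (simp add: emeasure_eq_measure)
  have val: "(\<integral>x. indicator (?A i) x * h i \<partial>M) = prob (?A i) * h i" for i
    by (simp add: Int_absorb2 subset_eq)
  have "integrable M (\<lambda>x. \<Sum>i\<le>n. indicator (?A i) x * h i)"
    by (rule Bochner_Integration.integrable_sum[OF int])
  then show "integrable M (\<lambda>x. h (\<iota> x))"
    by (rule Bochner_Integration.integrable_cong[THEN iffD2, rotated 2]) (simp_all only: eq)
  have "(\<integral>x. h (\<iota> x) \<partial>M) = (\<integral>x. (\<Sum>i\<le>n. indicator (?A i) x * h i) \<partial>M)"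
    by (intro Bochner_Integration.integral_cong refl eq)
  also have "\<dots> = (\<Sum>i\<le>n. prob (?A i) * h i)"
    by (simp only: Bochner_Integration.integral_sum[OF int] val)
  finally show "(\<integral>x. h (\<iota> x) \<partial>M) = (\<Sum>i\<le>n. prob (?A i) * h i)" .
qed

lemma integral_eq_bounded_limit:
  fixes g :: "nat \<Rightarrow> 'a \<Rightarrow> real"
  assumes fin: "finite_measure P" "finite_measure Q" and sp: "space P = space Q"
    and g: "\<And>n. g n \<in> borel_measurable P" "\<And>n. g n \<in> borel_measurable Q"
    and bd: "\<And>n x. x \<in> space P \<Longrightarrow> \<bar>g n x\<bar> \<le> B"
    and lim: "\<And>x. x \<in> space P \<Longrightarrow> (\<lambda>n. g n x) \<longlonglongrightarrow> h x"
    and eq: "\<And>n. (\<integral>x. g n x \<partial>P) = (\<integral>x. g n x \<partial>Q)"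
  shows "(\<integral>x. h x \<partial>P) = (\<integral>x. h x \<partial>Q)"
proof (rule LIMSEQ_unique)
  have "(\<lambda>n. \<integral>x. g n x \<partial>M) \<longlonglongrightarrow> (\<integral>x. h x \<partial>M)"
    if "finite_measure M" "space M = space P" "\<And>n. g n \<in> borel_measurable M" for M
  proof (rule integral_dominated_convergence[where w = "\<lambda>_. B"])
    show "h \<in> borel_measurable M"
      by (rule borel_measurable_LIMSEQ_real[where u = g]) (use that lim in auto)
    show "integrable M (\<lambda>_. B)" using that(1) by (rule finite_measure.integrable_const)
  qed (use that lim bd in auto)
  note limit = this
  show "(\<lambda>n. \<integral>x. g n x \<partial>P) \<longlonglongrightarrow> (\<integral>x. h x \<partial>P)"
    by (rule limit[OF fin(1) refl g(1)])
  show "(\<lambda>n. \<integral>x. g n x \<partial>P) \<longlonglongrightarrow> (\<integral>x. h x \<partial>Q)"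
    unfolding eq by (rule limit[OF fin(2) sp[symmetric] g(2)])
qed

text \<open>
  The indicator of \<open>a < f\<close> is reached from the powers of \<open>f\<close> by two bounded pointwise limits:
  \<open>exp (- c * f ^ n)\<close> is a power series in \<open>f ^ n\<close>, and \<open>exp (- (f / a) ^ n / n)\<close> tends to \<open>1\<close> where
  \<open>f \<le> a\<close> and to \<open>0\<close> where \<open>a < f\<close>. The factor \<open>1 / n\<close> decides the case \<open>f = a\<close>.
\<close>

lemma integral_indicator_greater_eq:
  fixes f w :: "'a \<Rightarrow> real"
  assumes fin: "finite_measure P" "finite_measure Q" and sp: "space P = space Q"
    and f: "f \<in> borel_measurable P" "f \<in> borel_measurable Q"
    and w: "w \<in> borel_measurable P" "w \<in> borel_measurable Q"
    and f01: "\<And>x. x \<in> space P \<Longrightarrow> 0 \<le> f x \<and> f x \<le> 1"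
    and w01: "\<And>x. x \<in> space P \<Longrightarrow> \<bar>w x\<bar> \<le> 1" and a: "a > 0"
    and eq: "\<And>k. (\<integral>x. w x * f x ^ k \<partial>P) = (\<integral>x. w x * f x ^ k \<partial>Q)"
  shows "(\<integral>x. w x * (if a < f x then 1 else 0) \<partial>P) = (\<integral>x. w x * (if a < f x then 1 else 0) \<partial>Q)"
proof -
  note [measurable] = f w
  have int: "integrable M (\<lambda>x. w x * f x ^ k)"
    if "finite_measure M" "space M = space P" "f \<in> borel_measurable M" "w \<in> borel_measurable M"
    for M k
  proof (rule finite_measure.integrable_const_bound[OF that(1), where B = 1])
    note [measurable] = that(3,4)
    show "(\<lambda>x. w x * f x ^ k) \<in> borel_measurable M" by measurable
    have "\<bar>w x\<bar> * \<bar>f x ^ k\<bar> \<le> 1" if "x \<in> space P" for x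
      using w01[OF that] f01[OF that] by (intro mult_le_one) (auto simp: power_le_one)
    then show "AE x in M. norm (w x * f x ^ k) \<le> 1"
      using that(2) by (auto simp: abs_mult)
  qed
  have exp_eq: "(\<integral>x. w x * exp (- c * f x ^ n) \<partial>P) = (\<integral>x. w x * exp (- c * f x ^ n) \<partial>Q)" for c n
  proof (rule integral_eq_bounded_limit[OF fin sp])
    let ?g = "\<lambda>N x. w x * (\<Sum>k<N. (- c * f x ^ n) ^ k /\<^sub>R fact k)"
    show "?g N \<in> borel_measurable P" "?g N \<in> borel_measurable Q" for N by measurable
    show "(\<lambda>N. ?g N x) \<longlonglongrightarrow> w x * exp (- c * f x ^ n)" for x
      using exp_converges[of "- c * f x ^ n"] by (intro tendsto_mult_left) (simp add: sums_def)
    show "\<bar>?g N x\<bar> \<le> exp \<bar>c\<bar>" if x: "x \<in> space P" for N x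
    proof -
      have "\<bar>\<Sum>k<N. (- c * f x ^ n) ^ k /\<^sub>R fact k\<bar> \<le> (\<Sum>k<N. \<bar>(- c * f x ^ n) ^ k /\<^sub>R fact k\<bar>)"
        by (rule sum_abs)
      also have "\<dots> \<le> (\<Sum>k<N. \<bar>c\<bar> ^ k /\<^sub>R fact k)"
      proof (rule sum_mono)
        fix k
        have "\<bar>c * f x ^ n\<bar> \<le> \<bar>c\<bar>"
          using f01[OF x] by (simp add: abs_mult mult_left_le power_le_one)
        then have "\<bar>c * f x ^ n\<bar> ^ k \<le> \<bar>c\<bar> ^ k" by (intro power_mono) auto
        then show "\<bar>(- c * f x ^ n) ^ k /\<^sub>R fact k\<bar> \<le> \<bar>c\<bar> ^ k /\<^sub>R fact k"
          by (simp add: abs_mult power_abs)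
      qed
      also have "\<dots> \<le> exp \<bar>c\<bar>"
        using exp_converges[of "\<bar>c\<bar>"] sum_le_suminf[of "\<lambda>k. \<bar>c\<bar> ^ k /\<^sub>R fact k" "{..<N}"]
        by (simp add: sums_iff)
      finally have "\<bar>w x\<bar> * \<bar>\<Sum>k<N. (- c * f x ^ n) ^ k /\<^sub>R fact k\<bar> \<le> 1 * exp \<bar>c\<bar>"
        using w01[OF x] by (intro mult_mono) auto
      then show ?thesis by (simp add: abs_mult)
    qed
    have expand: "?g N x = (\<Sum>k<N. ((- c) ^ k / fact k) * (w x * f x ^ (n * k)))" for N x
      unfolding sum_distrib_left
      by (intro sum.cong refl) (simp add: power_mult_distrib[of "- c", simplified] power_mult[symmetric] divide_inverse mult_ac)
    show "(\<integral>x. ?g N x \<partial>P) = (\<integral>x. ?g N x \<partial>Q)" for N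
      unfolding expand using int[OF fin(1)] int[OF fin(2)] sp f w
      by (subst (1 2) Bochner_Integration.integral_sum) (simp_all add: eq)
  qed
  show ?thesis
  proof (rule integral_eq_bounded_limit[OF fin sp])
    let ?g = "\<lambda>n x. w x * (1 - exp (- (inverse (a ^ n) / real n) * f x ^ n))"
    show "?g n \<in> borel_measurable P" "?g n \<in> borel_measurable Q" for n by measurable
    show "\<bar>?g n x\<bar> \<le> 1" if x: "x \<in> space P" for n x
    proof -
      have "0 \<le> inverse (a ^ n) / real n * f x ^ n"
        using a f01[OF x] by simp
      then have "\<bar>1 - exp (- (inverse (a ^ n) / real n) * f x ^ n)\<bar> \<le> 1" by simp
      then show ?thesis using w01[OF x] by (simp add: abs_mult mult_le_one)
    qed
    show "(\<lambda>n. ?g n x) \<longlonglongrightarrow> w x * (if a < f x then 1 else 0)" if x: "x \<in> space P" for x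
    proof -
      define q where "q = f x / a"
      have q0: "0 \<le> q" using f01[OF x] a by (simp add: q_def)
      have q: "- (inverse (a ^ n) / real n) * f x ^ n = - (q ^ n / real n)" for n
        by (simp add: q_def power_divide field_simps)
      have "(\<lambda>n. exp (- (q ^ n / real n))) \<longlonglongrightarrow> (if a < f x then 0 else 1)"
      proof (cases "a < f x")
        case True
        then have "1 < q" using a by (simp add: q_def)
        have "(\<lambda>n. real n / q ^ n) \<longlonglongrightarrow> 0"
          using lim_n_over_pown[of q] \<open>1 < q\<close> by simp
        moreover have "eventually (\<lambda>n. norm (exp (- (q ^ n / real n))) \<le> real n / q ^ n) sequentially"
          using eventually_gt_at_top[of 0]
        proof eventually_elim
          case (elim n)
          have pos: "0 < q ^ n / real n" using elim \<open>1 < q\<close> by simp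
          have "q ^ n / real n \<le> exp (q ^ n / real n)"
            using exp_ge_add_one_self[of "q ^ n / real n"] by linarith
          then have "inverse (exp (q ^ n / real n)) \<le> inverse (q ^ n / real n)"
            using pos by (rule le_imp_inverse_le)
          then show ?case by (simp add: exp_minus)
        qed
        ultimately have "(\<lambda>n. exp (- (q ^ n / real n))) \<longlonglongrightarrow> 0"
          by (rule Lim_null_comparison[rotated])
        then show ?thesis using True by simp
      next
        case False
        then have "q \<le> 1" using a by (simp add: q_def)
        then have "norm (q ^ n / real n) \<le> 1 / real n" for n
          using q0 by (simp add: divide_right_mono power_le_one)
        then have "(\<lambda>n. q ^ n / real n) \<longlonglongrightarrow> 0"
          by (intro Lim_null_comparison[OF _ lim_1_over_n] always_eventually allI)
        then have "(\<lambda>n. exp (- (q ^ n / real n))) \<longlonglongrightarrow> exp (- 0)"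
          by (intro tendsto_exp tendsto_minus)
        then show ?thesis using False by simp
      qed
      then have "(\<lambda>n. ?g n x) \<longlonglongrightarrow> w x * (1 - (if a < f x then 0 else 1))"
        unfolding q by (intro tendsto_mult_left tendsto_diff tendsto_const)
      then show ?thesis by (simp split: if_splits)
    qed
    show "(\<integral>x. ?g n x \<partial>P) = (\<integral>x. ?g n x \<partial>Q)" for n
    proof -
      let ?c = "inverse (a ^ n) / real n"
      have int': "integrable M (\<lambda>x. w x * exp (- ?c * f x ^ n))"
        if "finite_measure M" "space M = space P" "f \<in> borel_measurable M" "w \<in> borel_measurable M"
        for M
      proof (rule finite_measure.integrable_const_bound[OF that(1), where B = 1])
        note [measurable] = that(3,4)
        show "(\<lambda>x. w x * exp (- ?c * f x ^ n)) \<in> borel_measurable M" by measurable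
        have "\<bar>w x\<bar> * exp (- ?c * f x ^ n) \<le> 1" if "x \<in> space P" for x
          using w01[OF that] f01[OF that] a by (intro mult_le_one) auto
        then show "AE x in M. norm (w x * exp (- ?c * f x ^ n)) \<le> 1"
          using that(2) by (auto simp: abs_mult)
      qed
      have "(\<integral>x. ?g n x \<partial>M) = (\<integral>x. w x * f x ^ 0 \<partial>M) - (\<integral>x. w x * exp (- ?c * f x ^ n) \<partial>M)"
        if "finite_measure M" "space M = space P" "f \<in> borel_measurable M" "w \<in> borel_measurable M"
        for M
        using int[OF that, of 0] int'[OF that]
        by (subst Bochner_Integration.integral_diff[symmetric]) (simp_all add: right_diff_distrib)
      from this[OF fin(1)] this[OF fin(2)] show ?thesis
        using sp f w eq[of 0] exp_eq[of ?c n] by simp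
    qed
  qed
qed

section \<open>Measures that agree on balls\<close>

locale ball_agreeing_measures =
  fixes m :: "'a metric" and P Q :: "'a measure"
  assumes P: "P \<in> borel_prob_measures m" and Q: "Q \<in> borel_prob_measures m"
    and separable: "separable_space (mtopology_of m)"
    and balls: "\<And>x r. \<lbrakk>x \<in> mspace m; r > 0\<rbrakk>
      \<Longrightarrow> emeasure P (mball_of m x r) = emeasure Q (mball_of m x r)"
begin

sublocale P: prob_space P using P by (rule prob_space_borel_prob_measures)
sublocale Q: prob_space Q using Q by (rule prob_space_borel_prob_measures)

lemma space_P [simp]: "space P = mspace m" and space_Q [simp]: "space Q = mspace m"
  using P Q by (simp_all add: space_borel_prob_measures)

text \<open>
  The balls around \<open>x\<close> give the law of the distance to \<open>x\<close>. The sign turns an open ball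
  into a ray to the right.
\<close>

lemma distr_mdist_eq:
  assumes x: "x \<in> mspace m"
  shows "distr P borel (\<lambda>y. - mdist m x y) = distr Q borel (\<lambda>y. - mdist m x y)"
proof (rule measure_eqI_lessThan)
  have [measurable]: "mdist m x \<in> borel_measurable P" "mdist m x \<in> borel_measurable Q"
    by (rule mdist_measurable[OF P x] mdist_measurable[OF Q x])+
  show "emeasure (distr P borel (\<lambda>y. - mdist m x y)) {r<..} < \<infinity>" for r
    by (simp add: emeasure_distr less_top[symmetric])
  have ball: "(\<lambda>y. - mdist m x y) -` {r<..} \<inter> mspace m = mball_of m x (- r)" for r
    using x by auto
  have "emeasure P (mball_of m x (- r)) = emeasure Q (mball_of m x (- r))" for r
  proof (cases "r < 0")
    case True
    then show ?thesis using balls[OF x, of "- r"] by simp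
  next
    case False
    then have "\<not> mdist m x y < - r" for y
      using mdist_nonneg[of m x y] by linarith
    then have "mball_of m x (- r) = {}" by auto
    then show ?thesis by simp
  qed
  then show "emeasure (distr P borel (\<lambda>y. - mdist m x y)) {r<..}
      = emeasure (distr Q borel (\<lambda>y. - mdist m x y)) {r<..}" for r
    by (simp add: emeasure_distr ball)
qed simp_all

lemma integral_mdist_eq:
  fixes g :: "real \<Rightarrow> real"
  assumes x: "x \<in> mspace m" and g [measurable]: "g \<in> borel_measurable borel"
  shows "(\<integral>y. g (mdist m x y) \<partial>P) = (\<integral>y. g (mdist m x y) \<partial>Q)"
proof -
  have [measurable]: "mdist m x \<in> borel_measurable P" "mdist m x \<in> borel_measurable Q"
    by (rule mdist_measurable[OF P x] mdist_measurable[OF Q x])+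
  have "(\<integral>y. g (- u y) \<partial>M) = (\<integral>u. g (- u) \<partial>distr M borel u)"
    if "u \<in> borel_measurable M" for u :: "'a \<Rightarrow> real" and M
    using that by (subst integral_distr) simp_all
  from this[of "\<lambda>y. - mdist m x y" P] this[of "\<lambda>y. - mdist m x y" Q] show ?thesis
    by (simp add: distr_mdist_eq[OF x])
qed

end

locale embedded_ball_agreeing_measures = ball_agreeing_measures m P Q + real_inner_space H
  for m :: "'a metric" and P Q and H :: "'v inner_module" +
  fixes f :: "'a \<Rightarrow> 'v"
  assumes f_in [simp]: "x \<in> mspace m \<Longrightarrow> f x \<in> carrier H"
    and f_dist: "\<lbrakk>x \<in> mspace m; y \<in> mspace m\<rbrakk> \<Longrightarrow> ip_dist H (f x) (f y) = mdist m x y"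
begin

text \<open>Discretising with \<open>nearest\<close> turns \<open>P - Q\<close> into weights \<open>c n i\<close> at the points \<open>s i\<close>, \<open>i \<le> n\<close>. The
  Cauchy--Schwarz inequality for the Gaussian kernel at these points and \<open>z\<close> bounds the square of the
  discretised integral difference by the discretised energy. The energy tends to zero: its inner
  integral tends to the difference of the integrals of a Gaussian centred in \<open>m\<close>.\<close>

lemma integral_Gaussian_eq:
  assumes z: "z \<in> carrier H" and t: "0 \<le> t"
  shows "(\<integral>y. exp (- (t * (ip_dist H z (f y))\<^sup>2)) \<partial>P) = (\<integral>y. exp (- (t * (ip_dist H z (f y))\<^sup>2)) \<partial>Q)"
proof -
  obtain s where s: "\<And>i. s i \<in> mspace m"
    and dense: "\<And>x e. \<lbrakk>x \<in> mspace m; e > 0\<rbrakk> \<Longrightarrow> \<exists>i :: nat. mdist m (s i) x < e"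
    using separable_space_dense_sequence[OF separable] P.not_empty by auto
  define G where "G d = exp (- (t * d\<^sup>2))" for d
  have G_bd: "\<bar>G d\<bar> \<le> 1" for d using t by (simp add: G_def)
  have G_cont: "(\<lambda>n. G (a n)) \<longlonglongrightarrow> G b" if "a \<longlonglongrightarrow> b" for a b
    unfolding G_def using that by (intro tendsto_intros)
  let ?\<iota> = "nearest m s"
  have near: "?\<iota> n \<in> measurable P (count_space UNIV)" "?\<iota> n \<in> measurable Q (count_space UNIV)" for n
    by (rule nearest_measurable[OF P s], rule nearest_measurable[OF Q s])
  have nearest_lim: "(\<lambda>n. mdist m (s (?\<iota> n x)) x) \<longlonglongrightarrow> 0" if "x \<in> mspace m" for x
    using dense[OF that] by (rule nearest_tendsto)
  define c where "c n i = measure P {x \<in> mspace m. ?\<iota> n x = i} - measure Q {x \<in> mspace m. ?\<iota> n x = i}"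
    for n i
  have discr: "(\<Sum>i\<le>n. c n i * h i) = (\<integral>x. h (?\<iota> n x) \<partial>P) - (\<integral>x. h (?\<iota> n x) \<partial>Q)" for n h
    using P.integral_finite_range(2)[OF near(1)[of n] nearest_le, where h = h]
      Q.integral_finite_range(2)[OF near(2)[of n] nearest_le, where h = h]
    by (simp add: c_def left_diff_distrib sum_subtractf)
  have int: "integrable P (\<lambda>x. h (?\<iota> n x))" "integrable Q (\<lambda>x. h (?\<iota> n x))" for n and h :: "nat \<Rightarrow> real"
    using P.integral_finite_range(1)[OF near(1)[of n] nearest_le, where h = h]
      Q.integral_finite_range(1)[OF near(2)[of n] nearest_le, where h = h] by auto
  have limit: "(\<lambda>n. \<integral>x. h n (?\<iota> n x) \<partial>M) \<longlonglongrightarrow> (\<integral>x. l x \<partial>M)"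
    if M: "M \<in> {P, Q}" and bd: "\<And>n i. \<bar>h n i\<bar> \<le> B"
      and lim: "\<And>x. x \<in> mspace m \<Longrightarrow> (\<lambda>n. h n (?\<iota> n x)) \<longlonglongrightarrow> l x"
    for M and h :: "nat \<Rightarrow> nat \<Rightarrow> real" and l B
  proof (rule integral_dominated_convergence[where w = "\<lambda>_. B"])
    have sp: "space M = mspace m" using M by auto
    show meas: "(\<lambda>x. h n (?\<iota> n x)) \<in> borel_measurable M" for n
    proof -
      have "(\<lambda>x. h n (?\<iota> n x)) \<in> borel_measurable P" "(\<lambda>x. h n (?\<iota> n x)) \<in> borel_measurable Q"
        by (rule borel_measurable_integrable, rule int)+
      then show ?thesis using M by auto
    qed
    show "l \<in> borel_measurable M"
      by (rule borel_measurable_LIMSEQ_real[where u = "\<lambda>n x. h n (?\<iota> n x)"])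
        (simp_all add: lim sp meas)
    show "integrable M (\<lambda>_. B)"
      using M by auto
    show "AE x in M. (\<lambda>n. h n (?\<iota> n x)) \<longlonglongrightarrow> l x" using lim sp by auto
    show "AE x in M. norm (h n (?\<iota> n x)) \<le> B" for n using bd by auto
  qed

  \<comment> \<open>The potential of the discretised signed measure at \<open>s i\<close>; summing it against \<open>c n\<close>
    gives the energy.\<close>
  define v where "v n i = (\<Sum>j\<le>n. c n j * G (mdist m (s i) (s j)))" for n i
  have v_eq: "v n i = (\<integral>y. G (mdist m (s i) (s (?\<iota> n y))) \<partial>P) - (\<integral>y. G (mdist m (s i) (s (?\<iota> n y))) \<partial>Q)"
    for n i unfolding v_def by (rule discr)
  have int_bd: "\<bar>\<integral>y. h (?\<iota> n y) \<partial>M\<bar> \<le> 1"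
    if "M \<in> {P, Q}" "\<And>i. \<bar>h i\<bar> \<le> 1" for M n and h :: "nat \<Rightarrow> real"
  proof -
    have "prob_space M" using that(1) P.prob_space_axioms Q.prob_space_axioms by auto
    then interpret M: prob_space M .
    have "\<bar>\<integral>y. h (?\<iota> n y) \<partial>M\<bar> \<le> (\<integral>y. \<bar>h (?\<iota> n y)\<bar> \<partial>M)" by (rule integral_abs_bound)
    also have "\<dots> \<le> (\<integral>y. 1 \<partial>M)"
    proof (rule integral_mono)
      show "integrable M (\<lambda>y. \<bar>h (?\<iota> n y)\<bar>)"
        using that(1) int by (intro integrable_abs) auto
    qed (simp_all add: that(2))
    finally show ?thesis by (simp add: M.prob_space)
  qed
  have v_bd: "\<bar>v n i\<bar> \<le> 2" for n i
    using int_bd[of P "\<lambda>j. G (mdist m (s i) (s j))" n] int_bd[of Q "\<lambda>j. G (mdist m (s i) (s j))" n] G_bd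
    unfolding v_eq by (simp add: abs_le_iff)
  have v_lim: "(\<lambda>n. v n (?\<iota> n x)) \<longlonglongrightarrow> 0" if x: "x \<in> mspace m" for x
  proof -
    have "(\<lambda>n. G (mdist m (s (?\<iota> n x)) (s (?\<iota> n y)))) \<longlonglongrightarrow> G (mdist m x y)" if y: "y \<in> mspace m" for y
    proof (rule G_cont)
      have sum_lim: "(\<lambda>n. mdist m (s (?\<iota> n x)) x + mdist m (s (?\<iota> n y)) y) \<longlonglongrightarrow> 0"
        using tendsto_add[OF nearest_lim[OF x] nearest_lim[OF y]] by simp
      have "\<bar>mdist m (s i) (s j) - mdist m x y\<bar> \<le> mdist m (s i) x + mdist m (s j) y" for i j
      proof -
        have "mdist m (s i) (s j) \<le> mdist m (s i) x + mdist m x (s j)"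
          "mdist m x (s j) \<le> mdist m x y + mdist m y (s j)"
          "mdist m x y \<le> mdist m x (s i) + mdist m (s i) y"
          "mdist m (s i) y \<le> mdist m (s i) (s j) + mdist m (s j) y"
          using x y s by (auto intro!: mdist_triangle)
        then show ?thesis using mdist_commute[of m x "s i"] mdist_commute[of m y "s j"] by linarith
      qed
      then have "(\<lambda>n. mdist m (s (?\<iota> n x)) (s (?\<iota> n y)) - mdist m x y) \<longlonglongrightarrow> 0"
        by (intro Lim_null_comparison[OF always_eventually sum_lim]) simp
      then show "(\<lambda>n. mdist m (s (?\<iota> n x)) (s (?\<iota> n y))) \<longlonglongrightarrow> mdist m x y"
        by (simp only: LIM_zero_iff)
    qed
    then have "(\<lambda>n. v n (?\<iota> n x)) \<longlonglongrightarrow> (\<integral>y. G (mdist m x y) \<partial>P) - (\<integral>y. G (mdist m x y) \<partial>Q)"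
      unfolding v_eq
      by (intro tendsto_diff limit[of _ "\<lambda>n j. G (mdist m (s (?\<iota> n x)) (s j))" 1]) (simp_all add: G_bd)
    moreover have "(\<integral>y. G (mdist m x y) \<partial>P) = (\<integral>y. G (mdist m x y) \<partial>Q)"
      by (rule integral_mdist_eq[OF x]) (simp add: G_def[abs_def])
    ultimately show ?thesis by simp
  qed
  have "(\<lambda>n. \<Sum>i\<le>n. c n i * v n i) \<longlonglongrightarrow> 0"
    using tendsto_diff[OF limit[of P v 2 "\<lambda>_. 0"] limit[of Q v 2 "\<lambda>_. 0"]] v_bd v_lim
    unfolding discr by simp
  then have energy: "(\<lambda>n. \<Sum>i\<le>n. \<Sum>j\<le>n. c n i * c n j * G (mdist m (s i) (s j))) \<longlonglongrightarrow> 0"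
    by (simp add: v_def sum_distrib_left mult.assoc)

  \<comment> \<open>The option type keeps the index of \<open>z\<close> apart from those of the points of \<open>s\<close>, even if
    \<open>z\<close> is one of them.\<close>
  define h where "h = (\<lambda>i. case i of None \<Rightarrow> z | Some j \<Rightarrow> f (s j))"
  have h: "h i \<in> carrier H" for i using s z by (simp add: h_def split: option.split)
  have "psd_kernel UNIV (\<lambda>i j. G (ip_dist H (h i) (h j)))"
    unfolding G_def using h t by (rule psd_kernel_Gaussian)
  from psd_kernel_Cauchy_Schwarz[OF this, of "Some ` {..n}" None "\<lambda>i. c n (the i)" for n]
  have CS: "(\<Sum>i\<le>n. c n i * G (ip_dist H z (f (s i))))\<^sup>2
      \<le> (\<Sum>i\<le>n. \<Sum>j\<le>n. c n i * c n j * G (mdist m (s i) (s j)))" for n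
    using z s by (simp add: sum.reindex h_def f_dist G_def)
  have "(\<lambda>n. (\<Sum>i\<le>n. c n i * G (ip_dist H z (f (s i))))\<^sup>2) \<longlonglongrightarrow> 0"
    using CS by (intro Lim_null_comparison[OF _ energy] always_eventually allI) simp
  then have zero: "(\<lambda>n. \<Sum>i\<le>n. c n i * G (ip_dist H z (f (s i)))) \<longlonglongrightarrow> 0"
    by (auto dest!: tendsto_real_sqrt simp: tendsto_rabs_zero_iff)
  have "(\<lambda>n. G (ip_dist H z (f (s (?\<iota> n x))))) \<longlonglongrightarrow> G (ip_dist H z (f x))" if x: "x \<in> mspace m" for x
  proof (rule G_cont)
    have "\<bar>ip_dist H z (f (s i)) - ip_dist H z (f x)\<bar> \<le> mdist m (s i) x" for i
      using D.triangle[of z "f x" "f (s i)"] D.triangle[of z "f (s i)" "f x"] x s z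
        f_dist[of x "s i"] f_dist[of "s i" x] mdist_commute[of m x "s i"] by simp
    then have "(\<lambda>n. ip_dist H z (f (s (?\<iota> n x))) - ip_dist H z (f x)) \<longlonglongrightarrow> 0"
      by (intro Lim_null_comparison[OF _ nearest_lim[OF x]]) simp
    then show "(\<lambda>n. ip_dist H z (f (s (?\<iota> n x)))) \<longlonglongrightarrow> ip_dist H z (f x)"
      by (simp only: LIM_zero_iff)
  qed
  then have "(\<lambda>n. \<Sum>i\<le>n. c n i * G (ip_dist H z (f (s i))))
      \<longlonglongrightarrow> (\<integral>x. G (ip_dist H z (f x)) \<partial>P) - (\<integral>x. G (ip_dist H z (f x)) \<partial>Q)"
    unfolding discr
    by (intro tendsto_diff limit[of _ "\<lambda>n i. G (ip_dist H z (f (s i)))" 1])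
      (simp_all add: G_bd)
  then show ?thesis
    using LIMSEQ_unique[OF zero] by (fastforce simp: G_def)
qed

text \<open>For the barycentre \<open>z\<close> of the \<open>N\<close> points \<open>f x\<close>, the parallel axis theorem gives
  \<open>\<Sum>|f x - w|\<^sup>2 = C + N|z - w|\<^sup>2\<close> with \<open>C\<close> independent of \<open>w\<close>. Centres are listed with
  repetitions, which makes the powers of a Gaussian available as products.\<close>

lemma integral_exp_sum_eq:
  assumes xs: "set xs \<subseteq> mspace m"
  shows "(\<integral>y. exp (- (\<Sum>x\<leftarrow>xs. (mdist m x y)\<^sup>2)) \<partial>P) = (\<integral>y. exp (- (\<Sum>x\<leftarrow>xs. (mdist m x y)\<^sup>2)) \<partial>Q)"
proof (cases "xs = []")
  case True
  then show ?thesis using P.prob_space Q.prob_space by simp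
next
  case False
  define N where "N = real (length xs)"
  have "N > 0" using False by (simp add: N_def)
  have "set (map f xs) \<subseteq> carrier H" using xs by auto
  from ex_linear_combination[OF this, of "1 / N"] obtain z where z: "z \<in> carrier H"
    and ipz: "\<And>w. w \<in> carrier H \<Longrightarrow> ip H z w = (\<Sum>x\<leftarrow>map f xs. 1 / N * ip H x w)"
    by blast
  define C where "C = (\<Sum>x\<leftarrow>xs. ip H (f x) (f x)) - N * ip H z z"
  have sum_sq: "(\<Sum>x\<leftarrow>xs. (mdist m x y)\<^sup>2) = C + N * (ip_dist H z (f y))\<^sup>2" if y: "y \<in> mspace m" for y
  proof -
    have "(\<Sum>x\<leftarrow>map f xs. 1 / N * ip H x (f y)) = 1 / N * (\<Sum>x\<leftarrow>xs. ip H (f x) (f y))"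
      by (simp only: sum_list_const_mult list.map_comp comp_def)
    then have "N * ip H z (f y) = (\<Sum>x\<leftarrow>xs. ip H (f x) (f y))"
      using ipz[of "f y"] y \<open>N > 0\<close> by simp
    moreover have expand: "(\<Sum>x\<leftarrow>ys. (mdist m x y)\<^sup>2) = (\<Sum>x\<leftarrow>ys. ip H (f x) (f x))
        - 2 * (\<Sum>x\<leftarrow>ys. ip H (f x) (f y)) + real (length ys) * ip H (f y) (f y)"
      if "set ys \<subseteq> mspace m" for ys
      using that
    proof (induction ys)
      case (Cons x ys)
      then have "(mdist m x y)\<^sup>2 = ip H (f x) (f x) - 2 * ip H (f x) (f y) + ip H (f y) (f y)"
        using y f_dist[of x y] ip_dist_square[of "f x" "f y"] by simp
      then show ?case using Cons by (simp add: algebra_simps)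
    qed simp
    ultimately show ?thesis
      using expand[OF xs] y z by (simp add: ip_dist_square C_def N_def[symmetric] algebra_simps)
  qed
  have "(\<integral>y. exp (- (\<Sum>x\<leftarrow>xs. (mdist m x y)\<^sup>2)) \<partial>M)
      = exp (- C) * (\<integral>y. exp (- (N * (ip_dist H z (f y))\<^sup>2)) \<partial>M)" if "space M = mspace m" for M
    unfolding integral_mult_right_zero[symmetric]
    using that by (intro Bochner_Integration.integral_cong refl)
      (simp add: sum_sq exp_add[symmetric] del: minus_add_distrib)
  then show ?thesis using integral_Gaussian_eq[OF z, of N] \<open>N > 0\<close> by simp
qed

text \<open>The condition \<open>y \<in> mspace m\<close> makes the empty intersection the whole space.\<close>

definition ball_Int :: "('a \<times> real) list \<Rightarrow> 'a set" where
  "ball_Int ps = {y \<in> mspace m. \<forall>(x, r)\<in>set ps. mdist m x y < r}"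

lemma ball_Int_Cons:
  "x \<in> mspace m \<Longrightarrow> ball_Int ((x, r) # ps) = ball_Int ps \<inter> mball_of m x r"
  by (auto simp: ball_Int_def)

lemma openin_ball_Int:
  assumes "fst ` set ps \<subseteq> mspace m"
  shows "openin (mtopology_of m) (ball_Int ps)"
  using assms
proof (induction ps)
  case Nil
  have "ball_Int [] = topspace (mtopology_of m)" by (simp add: ball_Int_def)
  then show ?case using openin_topspace by metis
next
  case (Cons p ps)
  then show ?case
    by (cases p) (simp add: ball_Int_Cons openin_mball_of openin_Int)
qed

lemma ball_Int_in_sets:
  assumes "fst ` set ps \<subseteq> mspace m"
  shows "ball_Int ps \<in> sets P" "ball_Int ps \<in> sets Q"
  unfolding sets_borel_prob_measures[OF P] sets_borel_prob_measures[OF Q]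
  using openin_ball_Int[OF assms] by (simp_all add: sigma_sets.Basic)

lemma sum_mdist_sq_measurable:
  assumes "set xs \<subseteq> mspace m" "M \<in> borel_prob_measures m"
  shows "(\<lambda>y. \<Sum>x\<leftarrow>xs. (mdist m x y)\<^sup>2) \<in> borel_measurable M"
  using assms(1)
proof (induction xs)
  case (Cons x xs)
  have [measurable]: "mdist m x \<in> borel_measurable M"
    using Cons.prems by (intro mdist_measurable[OF assms(2)]) simp
  have [measurable]: "(\<lambda>y. \<Sum>x\<leftarrow>xs. (mdist m x y)\<^sup>2) \<in> borel_measurable M"
    using Cons by simp
  show ?case by simp
qed simp

text \<open>Ball indicators are traded for Gaussians one at a time. In the induction step the remaining
  factors form the weight \<open>w\<close>, and a power of the Gaussian at the new centre is absorbed by the list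
  \<open>xs\<close>, about which the induction hypothesis is general.\<close>

lemma integral_ball_Int_eq:
  assumes "fst ` set ps \<subseteq> mspace m" "set xs \<subseteq> mspace m"
  shows "(\<integral>y. indicator (ball_Int ps) y * exp (- (\<Sum>x\<leftarrow>xs. (mdist m x y)\<^sup>2)) \<partial>P)
    = (\<integral>y. indicator (ball_Int ps) y * exp (- (\<Sum>x\<leftarrow>xs. (mdist m x y)\<^sup>2)) \<partial>Q)"
  using assms
proof (induction ps arbitrary: xs)
  case Nil
  have "(\<integral>y. indicator (ball_Int []) y * exp (- (\<Sum>x\<leftarrow>xs. (mdist m x y)\<^sup>2)) \<partial>M)
      = (\<integral>y. exp (- (\<Sum>x\<leftarrow>xs. (mdist m x y)\<^sup>2)) \<partial>M)" if "space M = mspace m" for M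
    using that by (intro Bochner_Integration.integral_cong) (simp_all add: ball_Int_def)
  then show ?case using integral_exp_sum_eq[OF Nil.prems(2)] by simp
next
  case (Cons p ps)
  obtain x r where p: "p = (x, r)" by (cases p)
  have x: "x \<in> mspace m" and ps: "fst ` set ps \<subseteq> mspace m" using Cons.prems(1) p by auto
  show ?case
  proof (cases "r > 0")
    case False
    then have "\<not> mdist m x y < r" for y using mdist_nonneg[of m x y] by linarith
    then have "ball_Int (p # ps) = {}" by (auto simp: ball_Int_def p)
    then show ?thesis by simp
  next
    case True
    define w where "w y = indicator (ball_Int ps) y * exp (- (\<Sum>x\<leftarrow>xs. (mdist m x y)\<^sup>2))" for y
    define g where "g y = exp (- (mdist m x y)\<^sup>2)" for y
    have split: "indicator (ball_Int (p # ps)) y * exp (- (\<Sum>x\<leftarrow>xs. (mdist m x y)\<^sup>2))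
        = w y * (if exp (- r\<^sup>2) < g y then 1 else 0)" if "y \<in> mspace m" for y
    proof -
      have "exp (- r\<^sup>2) < g y \<longleftrightarrow> mdist m x y < r"
        using True by (auto simp: g_def intro: power_strict_mono dest: power_less_imp_less_base)
      then show ?thesis using that x by (auto simp: p ball_Int_Cons w_def indicator_def)
    qed
    have "(\<integral>y. w y * (if exp (- r\<^sup>2) < g y then 1 else 0) \<partial>P)
        = (\<integral>y. w y * (if exp (- r\<^sup>2) < g y then 1 else 0) \<partial>Q)"
    proof (rule integral_indicator_greater_eq)
      have meas: "mdist m x \<in> borel_measurable P" "mdist m x \<in> borel_measurable Q"
        by (rule mdist_measurable[OF P x] mdist_measurable[OF Q x])+
      note [measurable] = meas sum_mdist_sq_measurable[OF Cons.prems(2) P]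
        sum_mdist_sq_measurable[OF Cons.prems(2) Q] ball_Int_in_sets[OF ps]
      show "g \<in> borel_measurable P" "g \<in> borel_measurable Q"
        unfolding g_def[abs_def] by measurable
      show "w \<in> borel_measurable P" "w \<in> borel_measurable Q"
        unfolding w_def[abs_def] by measurable
      show "\<bar>w y\<bar> \<le> 1" for y
      proof -
        have "0 \<le> (\<Sum>x\<leftarrow>xs. (mdist m x y)\<^sup>2)" by (intro sum_list_nonneg) auto
        then show ?thesis by (simp add: w_def abs_mult indicator_def)
      qed
      show "(\<integral>y. w y * g y ^ k \<partial>P) = (\<integral>y. w y * g y ^ k \<partial>Q)" for k
      proof -
        have "w y * g y ^ k = indicator (ball_Int ps) y
            * exp (- (\<Sum>x\<leftarrow>replicate k x @ xs. (mdist m x y)\<^sup>2))" for y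
          by (simp add: w_def g_def exp_of_nat_mult[symmetric] exp_add[symmetric] sum_list_replicate
            del: minus_add_distrib)
        then show ?thesis using Cons.IH[OF ps, of "replicate k x @ xs"] Cons.prems(2) x
          by (simp add: subset_iff)
      qed
      show "finite_measure P" "finite_measure Q" by unfold_locales
    qed (auto simp: g_def)
    then show ?thesis
      by (subst (1 2) Bochner_Integration.integral_cong[OF refl split]) simp_all
  qed
qed

lemma emeasure_ball_Int_eq:
  assumes "fst ` set ps \<subseteq> mspace m"
  shows "emeasure P (ball_Int ps) = emeasure Q (ball_Int ps)"
proof -
  have "ball_Int ps \<inter> mspace m = ball_Int ps" by (auto simp: ball_Int_def)
  then show ?thesis
    using integral_ball_Int_eq[OF assms, of "[]"]
    by (simp add: P.emeasure_eq_measure Q.emeasure_eq_measure)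
qed

lemma sigma_sets_ball_Int:
  "sigma_sets (mspace m) {U. openin (mtopology_of m) U}
    = sigma_sets (mspace m) (ball_Int ` {ps. fst ` set ps \<subseteq> mspace m})" (is "_ = sigma_sets _ ?E")
proof (rule sigma_sets_eqI)
  fix U assume "U \<in> {U. openin (mtopology_of m) U}"
  then have U: "openin (mtopology_of m) U" by simp
  obtain s where s: "\<And>i. s i \<in> mspace m"
    and dense: "\<And>x e. \<lbrakk>x \<in> mspace m; e > 0\<rbrakk> \<Longrightarrow> \<exists>i :: nat. mdist m (s i) x < e"
    using separable_space_dense_sequence[OF separable] P.not_empty by auto
  interpret Metric_space "mspace m" "mdist m" by (rule Metric_space_mspace_mdist)
  define J where "J = {(i, n). mball_of m (s i) (inverse (real (Suc n))) \<subseteq> U}"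
  have "U = (\<Union>(i, n)\<in>J. mball_of m (s i) (inverse (real (Suc n))))"
  proof
    show "U \<subseteq> (\<Union>(i, n)\<in>J. mball_of m (s i) (inverse (real (Suc n))))"
    proof
      fix x assume "x \<in> U"
      then have x: "x \<in> mspace m" using openin_subset[OF U] by auto
      obtain e where e: "e > 0" "mball_of m x e \<subseteq> U"
        using U \<open>x \<in> U\<close> by (auto simp: mtopology_of_def mball_of_def openin_mtopology)
      obtain n where n: "inverse (real (Suc n)) < e / 2"
        using reals_Archimedean[of "e / 2"] e by auto
      obtain i where i: "mdist m (s i) x < inverse (real (Suc n))"
        using dense[OF x, of "inverse (real (Suc n))"] by auto
      have "y \<in> mball_of m x e" if "y \<in> mball_of m (s i) (inverse (real (Suc n)))" for y
      proof -
        have "mdist m x y \<le> mdist m x (s i) + mdist m (s i) y"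
          using that x s by (intro mdist_triangle) auto
        then show ?thesis using that x i n mdist_commute[of m x "s i"] by simp
      qed
      then have "mball_of m (s i) (inverse (real (Suc n))) \<subseteq> U" using e(2) by blast
      then have "(i, n) \<in> J" by (simp add: J_def)
      then show "x \<in> (\<Union>(i, n)\<in>J. mball_of m (s i) (inverse (real (Suc n))))"
        using i s x by (intro UN_I[of "(i, n)"]) auto
    qed
  qed (auto simp: J_def)
  moreover have "mball_of m (s i) r \<in> sigma_sets (mspace m) ?E" for i r
  proof -
    have "mball_of m (s i) r = ball_Int [(s i, r)]"
      using s by (auto simp: ball_Int_def)
    then show ?thesis using s by (intro sigma_sets.Basic) auto
  qed
  ultimately show "U \<in> sigma_sets (mspace m) ?E"
    by (auto intro!: sigma_sets_UNION)
next
  fix B assume "B \<in> ?E"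
  then show "B \<in> sigma_sets (mspace m) {U. openin (mtopology_of m) U}"
    using openin_ball_Int by (auto intro!: sigma_sets.Basic)
qed

theorem measures_eq: "P = Q"
proof (rule measure_eqI_generator_eq)
  let ?E = "ball_Int ` {ps. fst ` set ps \<subseteq> mspace m}"
  show "Int_stable ?E"
  proof (rule Int_stableI)
    fix A B assume "A \<in> ?E" "B \<in> ?E"
    then obtain ps qs where "A = ball_Int ps" "B = ball_Int qs"
      "fst ` set ps \<subseteq> mspace m" "fst ` set qs \<subseteq> mspace m" by auto
    then show "A \<inter> B \<in> ?E"
      by (intro image_eqI[of _ _ "ps @ qs"]) (auto simp: ball_Int_def)
  qed
  show "?E \<subseteq> Pow (mspace m)" by (auto simp: ball_Int_def)
  show "emeasure P A = emeasure Q A" if "A \<in> ?E" for A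
    using that emeasure_ball_Int_eq by auto
  show "sets P = sigma_sets (mspace m) ?E" "sets Q = sigma_sets (mspace m) ?E"
    using sigma_sets_ball_Int by (simp_all add: sets_borel_prob_measures[OF P] sets_borel_prob_measures[OF Q])
  show "range (\<lambda>_ :: nat. ball_Int []) \<subseteq> ?E" by auto
  show "(\<Union>i :: nat. ball_Int []) = mspace m" by (simp add: ball_Int_def)
qed simp

end

section \<open>Strictness of the inclusion\<close>

lemma isometric_to_hilbert_subsetE:
  fixes m :: "'a metric"
  assumes "isometric_to_hilbert_subset m"
  obtains H :: "(nat \<Rightarrow> ('a \<times> real) list) inner_module" and f
  where "real_hilbert_space H" "\<forall>x\<in>mspace m. f x \<in> carrier H"
    "\<forall>x\<in>mspace m. \<forall>y\<in>mspace m. ip_dist H (f x) (f y) = mdist m x y"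
proof -
  obtain H :: "(nat \<Rightarrow> ('a \<times> real) list) inner_module" and S
    where H: "real_hilbert_space H" and S: "S \<subseteq> carrier H"
      and iso: "isometric m (submetric (ip_metric H) S)"
    using assms by (auto simp: isometric_to_hilbert_subset_def)
  interpret real_hilbert_space H by (rule H)
  have "mspace (submetric (ip_metric H) S) = S" using S by auto
  with iso obtain f where f: "bij_betw f (mspace m) S"
    "\<forall>x\<in>mspace m. \<forall>y\<in>mspace m. ip_dist H (f x) (f y) = mdist m x y"
    unfolding isometric_def by auto
  show ?thesis
  proof (rule that[OF H _ f(2)])
    show "\<forall>x\<in>mspace m. f x \<in> carrier H"
      using f(1) S by (auto simp: bij_betw_def)
  qed
qed

lemma hilbertian_polish_ball_determined: "hilbertian_polish_spaces \<subseteq> ball_determined_spaces"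
proof
  fix m :: "'a metric" assume m: "m \<in> hilbertian_polish_spaces"
  then have "isometric_to_hilbert_subset m" by (simp add: hilbertian_polish_spaces_def)
  then obtain H :: "(nat \<Rightarrow> ('a \<times> real) list) inner_module" and f
    where H: "real_hilbert_space H" and f: "\<forall>x\<in>mspace m. f x \<in> carrier H"
      "\<forall>x\<in>mspace m. \<forall>y\<in>mspace m. ip_dist H (f x) (f y) = mdist m x y"
    by (rule isometric_to_hilbert_subsetE)
  interpret real_hilbert_space H by (rule H)
  have "P = Q"
    if "P \<in> borel_prob_measures m" "Q \<in> borel_prob_measures m"
      "\<forall>x\<in>mspace m. \<forall>r>0. emeasure P (mball_of m x r) = emeasure Q (mball_of m x r)" for P Q
  proof -
    interpret embedded_ball_agreeing_measures m P Q H f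
    proof unfold_locales
      show "separable_space (mtopology_of m)"
        using m by (simp add: hilbertian_polish_spaces_def)
    qed (use that f in auto)
    show ?thesis by (rule measures_eq)
  qed
  then show "m \<in> ball_determined_spaces" by (auto simp: ball_determined_spaces_def)
qed

lemma finite_uniformly_discrete_ball_determined:
  assumes fin: "finite (mspace m)" and r: "r > 0"
    and discrete: "\<And>x y. \<lbrakk>x \<in> mspace m; y \<in> mspace m; x \<noteq> y\<rbrakk> \<Longrightarrow> r \<le> mdist m x y"
  shows "m \<in> ball_determined_spaces"
proof -
  have ball: "mball_of m x r = {x}" if x: "x \<in> mspace m" for x
  proof -
    have "mdist m x x = 0" using x by simp
    then have "mdist m x x < r" using r by linarith
    moreover have "y = x" if "y \<in> mspace m" "mdist m x y < r" for y
      using discrete[OF x that(1)] that(2) by force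
    ultimately show ?thesis using x by auto
  qed
  have "P = Q"
    if P: "P \<in> borel_prob_measures m" and Q: "Q \<in> borel_prob_measures m"
      and eq: "\<forall>x\<in>mspace m. \<forall>r>0. emeasure P (mball_of m x r) = emeasure Q (mball_of m x r)" for P Q
  proof (rule measure_eqI)
    show "sets P = sets Q" using P Q by (simp add: sets_borel_prob_measures)
    fix A assume "A \<in> sets P"
    then have A: "A \<subseteq> mspace m" using sets.sets_into_space space_borel_prob_measures[OF P] by blast
    then have "finite A" using fin finite_subset by blast
    have "{x} \<in> sets P" "{x} \<in> sets Q" "emeasure P {x} = emeasure Q {x}" if "x \<in> A" for x
      using that A ball[of x] mball_of_in_sets[OF P, of x r] mball_of_in_sets[OF Q, of x r] eq r
      by (metis subsetD)+
    then show "emeasure P A = emeasure Q A"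
      using \<open>finite A\<close> by (simp add: emeasure_eq_sum_singleton)
  qed
  then show ?thesis by (auto simp: ball_determined_spaces_def)
qed

text \<open>The difference of the two sides is \<open>|a + b + c - 3z|\<^sup>2\<close>.\<close>

lemma (in real_inner_space) three_points_dist_sq_le:
  assumes o: "z \<in> carrier H" and abc: "a \<in> carrier H" "b \<in> carrier H" "c \<in> carrier H"
  shows "(ip_dist H a b)\<^sup>2 + (ip_dist H a c)\<^sup>2 + (ip_dist H b c)\<^sup>2
    \<le> 3 * ((ip_dist H z a)\<^sup>2 + (ip_dist H z b)\<^sup>2 + (ip_dist H z c)\<^sup>2)"
proof -
  let ?v = "(a \<oplus>\<^bsub>H\<^esub> b) \<oplus>\<^bsub>H\<^esub> (c \<oplus>\<^bsub>H\<^esub> ((- 3) \<odot>\<^bsub>H\<^esub> z))"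
  have "0 \<le> ip H ?v ?v" using assms by (intro ip_ge_zero) auto
  then show ?thesis
    using assms
    by (simp add: ip_dist_square ip_commute[of b a] ip_commute[of c a] ip_commute[of c b]
        ip_commute[of a z] ip_commute[of b z] ip_commute[of c z])
qed

text \<open>The path metric of a star graph with centre 0.\<close>

definition star_dist :: "real \<Rightarrow> real \<Rightarrow> real" where
  "star_dist x y = (if x = y then 0 else if x = 0 \<or> y = 0 then 1 else 2)"

lemma Metric_space_star_dist: "Metric_space {0, 1, 2, 3} star_dist"
  by unfold_locales (auto simp: star_dist_def)

text \<open>The centre and the three outer points would violate \<open>three_points_dist_sq_le\<close>, as
  \<open>4 + 4 + 4 > 3 * (1 + 1 + 1)\<close>.\<close>

lemma star_not_hilbertian:
  "\<not> isometric_to_hilbert_subset (metric ({0, 1, 2, 3}, star_dist))"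
proof
  assume "isometric_to_hilbert_subset (metric ({0, 1, 2, 3}, star_dist))"
  then obtain H :: "(nat \<Rightarrow> (real \<times> real) list) inner_module" and f
    where H: "real_hilbert_space H"
      and f: "\<forall>x\<in>mspace (metric ({0, 1, 2, 3}, star_dist)). f x \<in> carrier H"
        "\<forall>x\<in>mspace (metric ({0, 1, 2, 3}, star_dist)). \<forall>y\<in>mspace (metric ({0, 1, 2, 3}, star_dist)).
          ip_dist H (f x) (f y) = mdist (metric ({0, 1, 2, 3}, star_dist)) x y"
    by (rule isometric_to_hilbert_subsetE)
  interpret real_hilbert_space H by (rule H)
  interpret star: Metric_space "{0, 1, 2, 3}" star_dist by (rule Metric_space_star_dist)
  note f = f[unfolded star.mspace_metric star.mdist_metric]
  then show False
    using three_points_dist_sq_le[of "f 0" "f 1" "f 2" "f 3"]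
    by (simp add: f star_dist_def)
qed

theorem theorem2p10:
  shows "(hilbertian_polish_spaces :: 'a metric set) \<subseteq> ball_determined_spaces \<and>
    (\<exists>m :: real metric. m \<in> ball_determined_spaces \<and> m \<notin> hilbertian_polish_spaces)"
proof (intro conjI exI)
  show "(hilbertian_polish_spaces :: 'a metric set) \<subseteq> ball_determined_spaces"
    by (rule hilbertian_polish_ball_determined)
  interpret star: Metric_space "{0, 1, 2, 3}" star_dist by (rule Metric_space_star_dist)
  show "metric ({0, 1, 2, 3}, star_dist) \<in> ball_determined_spaces"
    by (rule finite_uniformly_discrete_ball_determined[where r = 1])
      (simp_all only: star.mspace_metric star.mdist_metric, auto simp: star_dist_def)
  show "metric ({0, 1, 2, 3}, star_dist) \<notin> hilbertian_polish_spaces"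
    using star_not_hilbertian by (simp add: hilbertian_polish_spaces_def)
qed

end
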